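(* Let $\mathbb{F}$ be a prime field and let $f \in \mathbb{F}[x_1,\ldots,x_n]$ be a cubic polynomial ($\deg(f)=3$) with $\|f\|_{U^3}=\delta$. Then there exist $c+1 = O(\log^2(1/\delta))$ quadratic polynomials $q_0,\ldots,q_{c} \in \mathbb{F}[x_1,\ldots,x_n]$ and $c$ linear functions $\ell_1,\ldots,\ell_{c} \in \mathbb{F}[x_1,\ldots,x_n]$ such that $$f = \sum_{j=1}^{c} \ell_j \cdot q_j +q_0.$$
   Context: For $f:\mathbb{F}^n\to\mathbb{F}$ and $y\in\mathbb{F}^n$, $\Delta_y(f)(x)=f(x+y)-f(x)$. The $d$-th Gowers norm is $\|f\|_{U^d} = \left|\mathbb{E}_{x,y_1,\ldots,y_d\in\mathbb{F}^n}[\omega^{\Delta_{y_d}\cdots\Delta_{y_1}(f)(x)}]\right|^{1/2^d}$ with $\omega=e^{2\pi i/|\mathbb{F}|}$. Polynomials are identified with the functions $\mathbb{F}^n\to\mathbb{F}$ they define (i.e. one works modulo $x_i^{p}-x_i$, $p=|\mathbb{F}|$), and the degree of a function is the least degree of a polynomial representing it. In the conclusion, "linear" and "quadratic" mean degree at most $1$ and $2$ (linear functions may have a constant term). The implied constants in $O(\cdot)$ may depend on the fixed field $\mathbb{F}$ but not on $n$, $f$ or $\delta$. *)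

theory Defs
  imports
    Complex_Main
    "HOL-Library.Poly_Mapping"
    "Jordan_Normal_Form.Matrix"
    "Berlekamp_Zassenhaus.Finite_Field"
begin

text \<open>
  The prime field is \<^typ>\<open>'p :: prime_card mod_ring\<close>. The space of vectors of length n is
  \<^term>\<open>carrier_vec n\<close>, so that n can be quantified inside a formula; accordingly the variables of
  an n-variate polynomial are numbered from 0 to n - 1.
\<close>

type_synonym 'a multipoly = "(nat \<Rightarrow>\<^sub>0 nat) \<Rightarrow>\<^sub>0 'a"

definition multipolys :: "nat \<Rightarrow> 'a::zero multipoly set" where
  "multipolys n = {P. \<forall>m \<in> Poly_Mapping.keys P. Poly_Mapping.keys m \<subseteq> {..<n}}"

definition multipoly_eval :: "'a::comm_semiring_1 multipoly \<Rightarrow> 'a vec \<Rightarrow> 'a" where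
  "multipoly_eval P x =
     (\<Sum>m \<in> Poly_Mapping.keys P.
        Poly_Mapping.lookup P m *
        (\<Prod>i \<in> Poly_Mapping.keys m. (x $ i) ^ Poly_Mapping.lookup m i))"

text \<open>The zero polynomial gets total degree 0; only upper bounds on the degree matter for it.\<close>

definition total_degree :: "'a::zero multipoly \<Rightarrow> nat" where
  "total_degree P =
     Max (insert 0
       ((\<lambda>m. \<Sum>i \<in> Poly_Mapping.keys m. Poly_Mapping.lookup m i) ` Poly_Mapping.keys P))"

text \<open>
  The degree of a function is the least total degree of a polynomial representing it. Over a
  finite field every function on \<^term>\<open>carrier_vec n\<close> is represented by some polynomial. The
  degree can be smaller than the total degree of a given representative: over the field with
  p elements, a p-th power of a variable has degree 1.
\<close>

definition fun_degree :: "nat \<Rightarrow> ('a::comm_semiring_1 vec \<Rightarrow> 'a) \<Rightarrow> nat" where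
  "fun_degree n f =
     (LEAST d. \<exists>P \<in> multipolys n.
        (\<forall>x \<in> carrier_vec n. multipoly_eval P x = f x) \<and> total_degree P = d)"

definition add_derivative ::
  "'a::ab_group_add vec \<Rightarrow> ('a vec \<Rightarrow> 'a) \<Rightarrow> 'a vec \<Rightarrow> 'a" where
  "add_derivative y f = (\<lambda>x. f (x + y) - f x)"

text \<open>The map sending a to the a-th power of exp (2 pi i / p).\<close>

definition add_character :: "'p::prime_card mod_ring \<Rightarrow> complex" where
  "add_character a = exp (2 * of_real pi * \<i> / of_nat CARD('p)) powi to_int_mod_ring a"

text \<open>
  For \<open>ys = [y\<^sub>1, \<dots>, y\<^sub>d]\<close>, the function \<^term>\<open>fold add_derivative ys f\<close>
  is the derivative of f first in direction \<open>y\<^sub>1\<close> and last in direction \<open>y\<^sub>d\<close>.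
\<close>

definition gowers_norm ::
  "nat \<Rightarrow> nat \<Rightarrow> ('p::prime_card mod_ring vec \<Rightarrow> 'p mod_ring) \<Rightarrow> real" where
  "gowers_norm n d f =
     (let S = carrier_vec n \<times> {ys. length ys = d \<and> set ys \<subseteq> carrier_vec n} in
      root (2 ^ d)
        (cmod ((\<Sum>(x, ys) \<in> S. add_character (fold add_derivative ys f x)) / of_nat (card S))))"

end

theory Submission
  imports Defs "HOL-Library.Function_Algebras"
begin

text \<open>
  The third derivative T of a cubic f is a symmetric trilinear form, f has degree at most 2 on
  every subspace U on which T vanishes identically, and a subspace of codimension c with this
  property gives a decomposition with c products. Orthogonality of characters turns the eighth
  power \<open>\<epsilon>\<close> of the norm into the density of the pairs (x, y) with \<open>T x y = 0\<close>, so the set A of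
  all x for which the radical of the bilinear form \<open>T x\<close> has density at least \<open>\<epsilon> / 2\<close> is itself of
  density at least \<open>\<epsilon> / 2\<close>. A growth argument produces a subspace W containing A, each of whose
  elements is a combination of \<open>O(log (1 / \<epsilon>))\<close> elements of A; ranks being subadditive, all forms
  \<open>T x\<close> with x in W have rank \<open>R = O(log\<^sup>2 (1 / \<epsilon>))\<close>. Finally, on the radical of a form \<open>T x\<close> of
  maximal rank R all ranks are at most R / 2, so iterating costs codimension at most 2 R until T
  vanishes. Throughout, ranks and codimensions are replaced by cardinalities of finite subspaces.
\<close>

section \<open>Biased trilinear forms\<close>

context vector_space
begin

text \<open>Multiplicative form of dim H + dim K \<le> dim W + dim (H \<inter> K): the difference
  map from \<open>H \<times> K\<close> to W has fibres no larger than
  \<open>H \<inter> K\<close>.\<close>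

lemma card_subspaces_mult_le:
  assumes W: "subspace W" "finite W" and H: "subspace H" "H \<subseteq> W" and K: "subspace K" "K \<subseteq> W"
  shows "card H * card K \<le> card W * card (H \<inter> K)"
proof -
  have fin: "finite H" "finite K"
    using W H K finite_subset by auto
  let ?d = "\<lambda>(h, k). h - k"
  have img: "?d ` (H \<times> K) \<subseteq> W"
    using W H K by (auto intro!: subspace_diff)
  have fibre: "card {u \<in> H \<times> K. ?d u = w} \<le> card (H \<inter> K)" for w
  proof (cases "{u \<in> H \<times> K. ?d u = w} = {}")
    case False
    then obtain h0 k0 where 0: "h0 \<in> H" "k0 \<in> K" "h0 - k0 = w" by auto
    show ?thesis
    proof (rule card_inj_on_le[of "\<lambda>(h, k). h - h0"])
      show "inj_on (\<lambda>(h, k). h - h0) {u \<in> H \<times> K. ?d u = w}"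
        by (auto simp: inj_on_def)
      show "(\<lambda>(h, k). h - h0) ` {u \<in> H \<times> K. ?d u = w} \<subseteq> H \<inter> K"
      proof clarify
        fix h k assume u: "h \<in> H" "k \<in> K" "w = h - k"
        then have "h - h0 = k - k0" using 0 by (simp add: algebra_simps)
        moreover have "k - k0 \<in> K" using u 0 K by (auto intro: subspace_diff)
        moreover have "h - h0 \<in> H" using u 0 H by (auto intro: subspace_diff)
        ultimately show "h - h0 \<in> H \<inter> K" by auto
      qed
    qed (use fin in auto)
  qed (simp only: card.empty le0)
  have "card H * card K = card (H \<times> K)"
    by (simp add: card_cartesian_product)
  also have "\<dots> = (\<Sum>w\<in>W. card {u \<in> H \<times> K. ?d u = w})"
    using sum.group[of "H \<times> K" W ?d "\<lambda>_. 1::nat"] fin W(2) img by simp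
  also have "\<dots> \<le> (\<Sum>w\<in>W. card (H \<inter> K))"
    by (intro sum_mono fibre)
  finally show ?thesis by simp
qed

text \<open>The coset of H through a vector of W outside H is disjoint from H and as large.\<close>

lemma card_proper_subspace_le_half:
  assumes W: "subspace W" "finite W" and H: "subspace H" "H \<subset> W"
  shows "2 * card H \<le> card W"
proof -
  obtain w where w: "w \<in> W" "w \<notin> H" using H by auto
  have disj: "H \<inter> (\<lambda>h. w + h) ` H = {}"
  proof (rule ccontr)
    assume "H \<inter> (\<lambda>h. w + h) ` H \<noteq> {}"
    then obtain h where "h \<in> H" "w + h \<in> H" by auto
    then have "(w + h) - h \<in> H" using H by (blast intro: subspace_diff)
    with w show False by simp
  qed
  have fin: "finite H" using H W finite_subset by blast
  have "2 * card H = card (H \<union> (\<lambda>h. w + h) ` H)"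
    using disj fin by (subst card_Un_disjoint) (auto simp: card_image)
  also have "\<dots> \<le> card W"
    using H W w by (intro card_mono) (auto intro: subspace_add)
  finally show ?thesis .
qed

end

section \<open>Ranks of the forms \<open>T x\<close>, measured through their radicals\<close>

locale symmetric_trilinear = vector_space scale
  for scale :: "'a::field \<Rightarrow> 'g::ab_group_add \<Rightarrow> 'g" (infixr \<open>*s\<close> 75) +
  fixes T :: "'g \<Rightarrow> 'g \<Rightarrow> 'g \<Rightarrow> 'a"
  assumes T_add: "T (x + x') y z = T x y z + T x' y z"
    and T_scale: "T (c *s x) y z = c * T x y z"
    and T_swap12: "T x y z = T y x z"
    and T_swap23: "T x y z = T x z y"
begin

lemma T_add2: "T x (y + y') z = T x y z + T x y' z"
  by (metis T_add T_swap12)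

lemma T_scale2: "T x (c *s y) z = c * T x y z"
  by (metis T_scale T_swap12)

lemma T_add3: "T x y (z + z') = T x y z + T x y z'"
  by (metis T_add2 T_swap23)

lemma T_zero1 [simp]: "T 0 y z = 0"
  using T_scale[of 0] by simp

lemma T_zero2 [simp]: "T x 0 z = 0"
  using T_scale2[of _ 0] by simp

lemma T_diff: "T (x - x') y z = T x y z - T x' y z"
  using T_add[of "x - x'" x'] by simp

text \<open>For a finite subspace W over a field with q elements,
  \<open>card W / card (rad W x)\<close> is q to the power of the rank of the bilinear form
  \<open>T x\<close> on W; this quotient replaces the rank throughout.\<close>

definition rad :: "'g set \<Rightarrow> 'g \<Rightarrow> 'g set" where
  "rad W x = {y \<in> W. \<forall>z\<in>W. T x y z = 0}"

lemma rad_subset: "rad W x \<subseteq> W"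
  by (auto simp: rad_def)

lemma finite_rad: "finite W \<Longrightarrow> finite (rad W x)"
  by (simp add: rad_def)

lemma card_zero_pairs:
  assumes "finite W"
  shows "card {(x, y). x \<in> W \<and> y \<in> W \<and> (\<forall>z\<in>W. T x y z = 0)} = (\<Sum>x\<in>W. card (rad W x))"
proof -
  have "{(x, y). x \<in> W \<and> y \<in> W \<and> (\<forall>z\<in>W. T x y z = 0)} = Sigma W (rad W)"
    by (auto simp: rad_def)
  then show ?thesis using assms by (simp add: finite_rad)
qed

lemma subspace_rad:
  assumes "subspace W"
  shows "subspace (rad W x)"
  using assms by (auto simp: rad_def subspace_def T_add2 T_scale2)

lemma rad_zero [simp]: "rad W 0 = W"
  by (auto simp: rad_def)

lemma rad_scale_subset: "rad W x \<subseteq> rad W (c *s x)"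
  by (auto simp: rad_def T_scale)

text \<open>Combined with \<open>card_subspaces_mult_le\<close>, this becomes subadditivity of the
  rank.\<close>

lemma rad_Int_subset_add: "rad W x \<inter> rad W x' \<subseteq> rad W (x + x')"
  by (auto simp: rad_def T_add)

lemma rad_Int_subset_diff: "rad W x \<inter> rad W x' \<subseteq> rad W (x - x')"
  by (auto simp: rad_def T_diff)

text \<open>
  A maximal rank form \<open>T x0\<close> with radical K halves the ranks on K: the radicals of \<open>T x\<close> and
  \<open>T (x + x0)\<close> both lie in \<open>{w. \<forall>k\<in>K. T x w k = 0}\<close>, and they meet inside the radical of \<open>T x\<close> on K.
\<close>

lemma card_rad_square_le:
  assumes W: "subspace W" "finite W" and x0: "x0 \<in> W" and x: "x \<in> W"
    and min: "\<And>u. u \<in> W \<Longrightarrow> card (rad W x0) \<le> card (rad W u)"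
  shows "card (rad W x0) ^ 3 \<le> card W * card (rad (rad W x0) x) ^ 2"
proof -
  define K where "K = rad W x0"
  define R where "R = rad K x"
  define Q where "Q = {w \<in> W. \<forall>k\<in>K. T x w k = 0}"
  have K: "subspace K" "K \<subseteq> W" unfolding K_def by (simp_all add: subspace_rad W rad_subset)
  have fK: "finite K" using K W finite_subset by blast
  have Q: "subspace Q" "Q \<subseteq> W" unfolding Q_def
    using W K by (auto simp: subspace_def T_add2 T_scale2)
  have fQ: "finite Q" using Q W finite_subset by blast
  have QK: "Q \<inter> K = R" unfolding Q_def R_def rad_def using K by auto
  have 1: "card Q * card K \<le> card W * card R"
    using card_subspaces_mult_le[OF W Q K] QK by simp
  have r1: "rad W x \<subseteq> Q" using K by (auto simp: rad_def Q_def)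
  have T0: "T x0 w k = 0" if "w \<in> W" "k \<in> K" for w k
    using that T_swap23[of x0 w k] by (auto simp: K_def rad_def)
  have r2: "rad W (x + x0) \<subseteq> Q"
  proof
    fix w assume w: "w \<in> rad W (x + x0)"
    then have "w \<in> W" by (simp add: rad_def)
    moreover have "T x w k = 0" if k: "k \<in> K" for k
    proof -
      have "T (x + x0) w k = 0" using w k K by (auto simp: rad_def)
      then show ?thesis using T0[OF \<open>w \<in> W\<close> k] by (simp add: T_add)
    qed
    ultimately show "w \<in> Q" by (simp add: Q_def)
  qed
  have r3: "rad W x \<inter> rad W (x + x0) \<subseteq> R"
  proof
    fix w assume w: "w \<in> rad W x \<inter> rad W (x + x0)"
    then have "w \<in> K" by (auto simp: K_def rad_def T_add)
    with w r1 QK show "w \<in> R" by auto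
  qed
  have fR: "finite R" using QK fK by auto
  have "card (rad W x) * card (rad W (x + x0)) \<le> card Q * card (rad W x \<inter> rad W (x + x0))"
    using card_subspaces_mult_le[OF Q(1) fQ subspace_rad[OF W(1)] r1 subspace_rad[OF W(1)] r2] .
  also have "\<dots> \<le> card Q * card R"
    using r3 fR by (intro mult_le_mono2 card_mono)
  finally have 2: "card (rad W x) * card (rad W (x + x0)) \<le> card Q * card R" .
  have "card K * card K \<le> card (rad W x) * card (rad W (x + x0))"
    unfolding K_def using W x x0 by (intro mult_le_mono min) (auto intro: subspace_add)
  \<comment> \<open>In dimensions the chain ends in 3 dim K \<le> dim W + 2 dim R, so dim K - dim R
    is at most half of dim W - dim K: the rank of \<open>T x\<close> on K is at most half of the
    maximal rank on W.\<close>
  with 2 have "card K * card K * card K \<le> card Q * card R * card K"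
    by (metis le_trans mult_le_mono1)
  also have "\<dots> = (card Q * card K) * card R" by (simp add: mult_ac)
  also have "\<dots> \<le> (card W * card R) * card R" using 1 by (rule mult_le_mono1)
  finally show ?thesis
    unfolding K_def[symmetric] R_def[symmetric] by (simp add: power2_eq_square power3_eq_cube mult_ac)
qed

text \<open>Induction on \<open>card W\<close>. If r is the maximal rank, passing to the radical K
  of a form of rank r costs codimension r and leaves ranks at most r / 2, for which the induction
  hypothesis costs another r. The total 2 r is the exponent 2 on N.\<close>

theorem bounded_rank_imp_vanishing_subspace:
  fixes N :: real
  assumes "subspace W" "finite W" and "N \<ge> 0"
    and "\<And>x. x \<in> W \<Longrightarrow> real (card W) \<le> N * real (card (rad W x))"
  shows "\<exists>U. subspace U \<and> U \<subseteq> W \<and> real (card W) \<le> N\<^sup>2 * real (card U) \<and>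
           (\<forall>x\<in>U. \<forall>y\<in>U. \<forall>z\<in>U. T x y z = 0)"
  using assms
proof (induction "card W" arbitrary: W N rule: less_induct)
  case less
  have "W \<noteq> {}" using less.prems(1) subspace_0 by auto
  then have "\<exists>x0\<in>W. \<forall>u\<in>W. card (rad W x0) \<le> card (rad W u)"
    using ex_has_least_nat[of "\<lambda>u. u \<in> W" _ "\<lambda>u. card (rad W u)"] by blast
  then obtain x0 where x0: "x0 \<in> W" and
    min: "\<And>u. u \<in> W \<Longrightarrow> card (rad W x0) \<le> card (rad W u)" by blast
  define K where "K = rad W x0"
  have K: "subspace K" "K \<subseteq> W"
    unfolding K_def by (simp_all add: subspace_rad less.prems rad_subset)
  have fK: "finite K" using K less.prems finite_subset by blast
  have "K \<noteq> {}" using K(1) subspace_0 by auto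
  then have posK: "card K > 0" using fK by (simp add: card_gt_0_iff)
  have posW: "card W > 0" using \<open>W \<noteq> {}\<close> less.prems(2) by (simp add: card_gt_0_iff)
  have WK: "real (card W) \<le> N * real (card K)" using less.prems(4)[OF x0] by (simp add: K_def)
  show ?case
  proof (cases "K = W")
    \<comment> \<open>Even the largest rank is zero here, and \<open>1 \<le> N\<close> lets W itself
      serve as U.\<close>
    case True
    have "rad W u = W" if "u \<in> W" for u
      using min[OF that] True rad_subset[of W u] less.prems(2)
      by (metis K_def card_subset_eq card_mono le_antisym)
    then have "\<forall>x\<in>W. \<forall>y\<in>W. \<forall>z\<in>W. T x y z = 0" by (auto simp: rad_def)
    moreover have "1 \<le> N" using WK True posW by simp
    then have "real (card W) \<le> N\<^sup>2 * real (card W)" by (simp add: mult_le_cancel_right1)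
    ultimately show ?thesis using less.prems(1) by blast
  next
    case False
    \<comment> \<open>Halving the rank means taking the square root of the index of K in W, so the
      induction hypothesis for K costs exactly that index \<open>M\<^sup>2\<close> once
      more.\<close>
    define M where "M = sqrt (real (card W) / real (card K))"
    have M0: "M \<ge> 0" and M2: "M\<^sup>2 = real (card W) / real (card K)" by (auto simp: M_def)
    have "real (card K) \<le> M * real (card (rad K x))" if "x \<in> K" for x
    proof (rule power2_le_imp_le)
      have "card K ^ 3 \<le> card W * card (rad K x) ^ 2"
        using card_rad_square_le[OF less.prems(1,2) x0 _ min] that K by (auto simp: K_def)
      then have "real (card K) ^ 3 \<le> real (card W) * real (card (rad K x)) ^ 2"
        by (metis of_nat_le_iff of_nat_mult of_nat_power)
      then have "(real (card K))\<^sup>2 \<le> real (card W) / real (card K) * (real (card (rad K x)))\<^sup>2"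
        using posK by (simp add: field_simps power2_eq_square power3_eq_cube)
      then show "(real (card K))\<^sup>2 \<le> (M * real (card (rad K x)))\<^sup>2"
        by (simp add: power_mult_distrib M2)
    qed (use M0 in auto)
    moreover have "card K < card W"
      using False K(2) less.prems(2) by (intro psubset_card_mono) auto
    ultimately obtain U where U: "subspace U" "U \<subseteq> K" "real (card K) \<le> M\<^sup>2 * real (card U)"
      "\<forall>x\<in>U. \<forall>y\<in>U. \<forall>z\<in>U. T x y z = 0"
      using less.hyps[of K M] K fK M0 by blast
    have MN: "M\<^sup>2 \<le> N" using WK posK by (simp add: M2 field_simps)
    have "real (card W) = M\<^sup>2 * real (card K)" using posK by (simp add: M2)
    also have "\<dots> \<le> M\<^sup>2 * (M\<^sup>2 * real (card U))" using U(3) by (intro mult_left_mono) auto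
    also have "\<dots> \<le> N * (N * real (card U))" using MN less.prems(3) by (intro mult_mono) auto
    finally have "real (card W) \<le> N\<^sup>2 * real (card U)" by (simp add: power2_eq_square mult_ac)
    then show ?thesis using U K(2) by blast
  qed
qed

text \<open>Two shifts of X that each keep more than 4/5 of X share more than 3/5 of it. Hence every
  v in X - X moves more than 3/5 of X into X. For two such v and w these parts overlap, and a common
  point a + v = b + w shows that v - w is again a difference of elements of X.\<close>

lemma almost_invariant_imp_subspace:
  assumes X: "finite X" "X \<noteq> {}" and scl: "\<And>c x. x \<in> X \<Longrightarrow> c *s x \<in> X"
    and inv: "\<And>x. x \<in> X \<Longrightarrow> 4 * card X < 5 * card (X \<inter> (\<lambda>y. y + x) ` X)"
  shows "subspace ((\<lambda>(x, y). x - y) ` (X \<times> X))"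
proof -
  let ?D = "(\<lambda>(x, y). x - y) ` (X \<times> X)"
  let ?t = "\<lambda>v. (\<lambda>y. y + v) ` X"
  have Dn: "3 * card X < 5 * card (X \<inter> ?t v)" if v: "v \<in> ?D" for v
  proof -
    obtain x y where xy: "x \<in> X" "y \<in> X" "v = x - y" using v by auto
    define P where "P = X \<inter> ?t x"
    define Q where "Q = X \<inter> ?t y"
    have "card P + card Q = card (P \<union> Q) + card (P \<inter> Q)"
      using X unfolding P_def Q_def by (intro card_Un_Int) auto
    moreover have "card (P \<union> Q) \<le> card X"
      using X unfolding P_def Q_def by (intro card_mono) auto
    moreover have "card (P \<inter> Q) \<le> card (X \<inter> ?t v)"
    proof (rule card_inj_on_le[of "\<lambda>u. u - y"])
      show "(\<lambda>u. u - y) ` (P \<inter> Q) \<subseteq> X \<inter> ?t v"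
        by (auto simp: P_def Q_def xy image_iff algebra_simps)
    qed (use X in \<open>auto simp: inj_on_def\<close>)
    ultimately show ?thesis using inv[OF xy(1)] inv[OF xy(2)] by (simp add: P_def Q_def)
  qed
  have diff: "v - w \<in> ?D" if "v \<in> ?D" "w \<in> ?D" for v w
  proof -
    define P where "P = X \<inter> ?t v"
    define Q where "Q = X \<inter> ?t w"
    have "card P + card Q = card (P \<union> Q) + card (P \<inter> Q)"
      using X unfolding P_def Q_def by (intro card_Un_Int) auto
    moreover have "card (P \<union> Q) \<le> card X"
      using X unfolding P_def Q_def by (intro card_mono) auto
    ultimately have "card (P \<inter> Q) > 0" using Dn[OF that(1)] Dn[OF that(2)] by (simp add: P_def Q_def)
    then have "P \<inter> Q \<noteq> {}" by force
    then obtain a b where ab: "a \<in> X" "b \<in> X" "a + v = b + w" by (auto simp: P_def Q_def)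
    then have "v - w = b - a" by (simp add: algebra_simps)
    then show ?thesis using ab by force
  qed
  have zero: "0 \<in> ?D" using X by (auto simp: image_iff)
  have "v + w \<in> ?D" if "v \<in> ?D" "w \<in> ?D" for v w
    using diff[OF that(1) diff[OF zero that(2)]] by simp
  moreover have "c *s v \<in> ?D" if "v \<in> ?D" for c v
    using that scl by (force simp: scale_right_diff_distrib)
  ultimately show ?thesis using zero by (auto simp: subspace_def)
qed

text \<open>Codimensions of radicals add, so their densities multiply. The inclusion is a hypothesis
  in order to cover both sums and differences of x and y.\<close>

lemma card_rad_add_ge:
  fixes a b :: real
  assumes V: "subspace V" "finite V" and "a \<ge> 0" "b \<ge> 0"
    and x: "a * card V \<le> card (rad V x)" and y: "b * card V \<le> card (rad V y)"
    and sub: "rad V x \<inter> rad V y \<subseteq> rad V z"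
  shows "a * b * card V \<le> card (rad V z)"
proof -
  have fin: "finite (rad V u)" for u using rad_subset V finite_subset by blast
  have "0 \<in> V" using V subspace_0 by blast
  then have pos: "card V > 0" using V by (auto simp: card_gt_0_iff)
  have "(a * card V) * (b * card V) \<le> real (card (rad V x)) * real (card (rad V y))"
    using assms by (intro mult_mono) auto
  also have "\<dots> \<le> real (card V) * real (card (rad V x \<inter> rad V y))"
    using card_subspaces_mult_le[OF V subspace_rad[OF V(1)] rad_subset subspace_rad[OF V(1)] rad_subset]
    by (metis of_nat_le_iff of_nat_mult)
  also have "\<dots> \<le> real (card V) * real (card (rad V z))"
    using card_mono[OF fin sub] by (intro mult_left_mono) auto
  finally show ?thesis using pos by (simp add: mult_ac)
qed

text \<open>
  A vector of A is added to the subspace S as long as this enlarges A + S by a factor 6/5, which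
  can happen only logarithmically often. At the end X = A + S is almost invariant under its own
  elements, and W is X - X.
\<close>

lemma dense_low_rank_imp_low_rank_subspace:
  fixes b :: real
  assumes V: "subspace V" "finite V" and b: "0 < b" "b \<le> 1"
    and A_def: "A = {x \<in> V. b * card V \<le> card (rad V x)}"
  shows "\<exists>W m. subspace W \<and> W \<subseteq> V \<and> A \<subseteq> W \<and> (6/5) ^ m * real (card A) \<le> card V \<and>
           (\<forall>x\<in>W. b ^ (m + 2) * card V \<le> card (rad V x))"
proof -
  have V0: "0 \<in> V" using V subspace_0 by blast
  then have posV: "card V > 0" using V by (auto simp: card_gt_0_iff)
  have A0: "0 \<in> A" using V0 b posV by (simp add: A_def)
  have AV: "A \<subseteq> V" by (auto simp: A_def)
  have fA: "finite A" using AV V finite_subset by blast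
  have posA: "card A > 0" using fA A0 by (auto simp: card_gt_0_iff)
  have Ascl: "c *s x \<in> A" if "x \<in> A" for c x
  proof -
    have "card (rad V x) \<le> card (rad V (c *s x))"
      using V finite_subset[OF rad_subset] by (intro card_mono rad_scale_subset) auto
    then show ?thesis using that V by (auto simp: A_def subspace_scale)
  qed
  let ?sum = "\<lambda>S. {x + s | x s. x \<in> A \<and> s \<in> S}"
  \<comment> \<open>State after m enlargements of S: A + S has grown by a factor 6/5 each time, and
    each added vector has cost one factor b in the density of the radicals.\<close>
  define good where "good m S \<longleftrightarrow> subspace S \<and> S \<subseteq> V \<and>
    (6/5) ^ m * real (card A) \<le> card (?sum S) \<and> (\<forall>s\<in>S. b ^ m * card V \<le> card (rad V s))" for m S
  have sumV: "?sum S \<subseteq> V" if "S \<subseteq> V" for S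
    using that AV V(1) by (auto intro!: subspace_add)
  have le: "(6/5) ^ m * real (card A) \<le> card V" if "good m S" for m S
  proof -
    have "card (?sum S) \<le> card V" using that V by (intro card_mono sumV) (auto simp: good_def)
    then show ?thesis using that by (auto simp: good_def)
  qed
  have "?sum {0} = A" by auto
  then have good0: "good 0 {0}" using V0 by (simp add: good_def)
  \<comment> \<open>Growth cannot outrun \<open>card V\<close>, so m is bounded and a last good
    stage exists.\<close>
  obtain k where k: "real (card V) < (6/5) ^ k" using real_arch_pow[of "6/5" "card V"] by auto
  have bound: "m \<le> k" if "good m S" for m S
  proof (rule ccontr)
    assume "\<not> m \<le> k"
    then have "(6/5::real) ^ k \<le> (6/5) ^ m" by (intro power_increasing) auto
    also have "\<dots> \<le> (6/5) ^ m * real (card A)" using posA by simp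
    finally show False using le[OF that] k by simp
  qed
  then obtain m where "\<exists>S. good m S" and "\<forall>m'. (\<exists>S. good m' S) \<longrightarrow> m' \<le> m"
    using ex_has_greatest_nat[of "\<lambda>m. \<exists>S. good m S" 0 "\<lambda>m. m" "Suc k"] good0
    by (auto simp: less_Suc_eq_le)
  then obtain S where S: "good m S" and "\<And>m' S'. good m' S' \<Longrightarrow> m' \<le> m" by metis
  then have max: "\<not> good (Suc m) S'" for S' by (metis Suc_n_not_le_n)
  have subS: "subspace S" and SV: "S \<subseteq> V" and radS: "\<And>s. s \<in> S \<Longrightarrow> b ^ m * card V \<le> card (rad V s)"
    using S by (auto simp: good_def)
  define X where "X = ?sum S"
  have fX: "finite X" using sumV[OF SV] V finite_subset unfolding X_def by blast
  have S0: "0 \<in> S" using subS subspace_0 by blast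
  have AX: "A \<subseteq> X" unfolding X_def using S0 add_0_right by (metis (mono_tags, lifting) mem_Collect_eq subsetI)
  have Xadd: "x + s \<in> X" if x: "x \<in> X" and s: "s \<in> S" for x s
  proof -
    obtain a t where "x = a + t" "a \<in> A" "t \<in> S" using x by (auto simp: X_def)
    moreover have "t + s \<in> S" using subspace_add[OF subS \<open>t \<in> S\<close> s] .
    ultimately show ?thesis unfolding X_def using add.assoc by blast
  qed
  have invA: "4 * card X < 5 * card (X \<inter> (\<lambda>y. y + a) ` X)" if a: "a \<in> A" for a
  proof (rule ccontr)
    \<comment> \<open>If the shift by a returns at most 4/5 of X to X, then X and X + a together
      have at least 6/5 \<open>card X\<close> elements. Both lie in A + S', where S' extends S by
      the multiples of a, so stage m + 1 would be good as well.\<close>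
    assume neg: "\<not> ?thesis"
    define S' where "S' = {s + c *s a | s c. s \<in> S}"
    have SI: "s + c *s a \<in> S'" if "s \<in> S" for s c using that by (auto simp: S'_def)
    have "subspace S'"
      unfolding subspace_def
    proof (intro conjI ballI allI)
      show "0 \<in> S'" using SI[OF S0, of 0] by simp
      fix x assume "x \<in> S'"
      then obtain s c where x: "x = s + c *s a" "s \<in> S" by (auto simp: S'_def)
      show "d *s x \<in> S'" for d
        using SI[of "d *s s" "d * c"] x subS by (simp add: scale_right_distrib subspace_scale)
      fix y assume "y \<in> S'"
      then obtain s' c' where y: "y = s' + c' *s a" "s' \<in> S" by (auto simp: S'_def)
      show "x + y \<in> S'"
        using SI[of "s + s'" "c + c'"] x y subS by (simp add: scale_left_distrib subspace_add algebra_simps)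
    qed
    moreover have "S' \<subseteq> V"
      using SV V a AV by (auto simp: S'_def intro!: subspace_add subspace_scale)
    moreover have "b ^ Suc m * card V \<le> card (rad V t)" if "t \<in> S'" for t
    proof -
      obtain s c where t: "t = s + c *s a" "s \<in> S" using \<open>t \<in> S'\<close> by (auto simp: S'_def)
      have "c *s a \<in> A" using a Ascl by blast
      then have "b * card V \<le> card (rad V (c *s a))" by (simp add: A_def)
      then have "b ^ m * b * card V \<le> card (rad V t)"
        using b t radS rad_Int_subset_add[of V s "c *s a"]
        by (intro card_rad_add_ge[OF V, of _ _ s "c *s a"]) auto
      then show ?thesis by (simp add: mult_ac)
    qed
    moreover have "(6/5) ^ Suc m * real (card A) \<le> card (?sum S')"
    proof -
      have fX': "finite (?sum S')"
        using sumV[OF \<open>S' \<subseteq> V\<close>] V finite_subset by blast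
      have "X \<union> (\<lambda>y. y + a) ` X \<subseteq> ?sum S'"
      proof -
        have "x + s \<in> ?sum S'" "x + s + a \<in> ?sum S'" if "x \<in> A" "s \<in> S" for x s
        proof -
          show "x + s \<in> ?sum S'" using that SI[OF that(2), of 0] by auto
          show "x + s + a \<in> ?sum S'" using that SI[OF that(2), of 1] by (auto simp: add.assoc)
        qed
        then show ?thesis unfolding X_def by auto
      qed
      then have "card (X \<union> (\<lambda>y. y + a) ` X) \<le> card (?sum S')" by (intro card_mono fX')
      moreover have "card X + card X = card (X \<union> (\<lambda>y. y + a) ` X) + card (X \<inter> (\<lambda>y. y + a) ` X)"
        using card_Un_Int[of X "(\<lambda>y. y + a) ` X"] fX by (simp add: card_image)
      ultimately have "6 * card X \<le> 5 * card (?sum S')" using neg by linarith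
      moreover have "(6/5) ^ m * real (card A) \<le> card X" using S by (simp add: good_def X_def)
      ultimately show ?thesis by simp
    qed
    ultimately have "good (Suc m) S'" by (simp add: good_def)
    with max show False by blast
  qed
  have invX: "4 * card X < 5 * card (X \<inter> (\<lambda>y. y + x) ` X)" if x: "x \<in> X" for x
  proof -
    obtain a s where as: "x = a + s" "a \<in> A" "s \<in> S" using x by (auto simp: X_def)
    \<comment> \<open>X absorbs S, so only the component of x in A affects the shifted set.\<close>
    have "(\<lambda>y. y + x) ` X = (\<lambda>y. y + a) ` X"
    proof (intro equalityI subsetI)
      fix v assume "v \<in> (\<lambda>y. y + x) ` X"
      then obtain y where "y \<in> X" "v = (y + s) + a" by (auto simp: as add_ac)
      then show "v \<in> (\<lambda>y. y + a) ` X" using Xadd as by auto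
    next
      fix v assume "v \<in> (\<lambda>y. y + a) ` X"
      then obtain y where "y \<in> X" "v = (y + - s) + x" by (auto simp: as)
      moreover from this have "y + - s \<in> X" using Xadd[of y "- s"] as subS subspace_neg by blast
      ultimately show "v \<in> (\<lambda>y. y + x) ` X" by blast
    qed
    then show ?thesis using invA[OF as(2)] by simp
  qed
  have Xscl: "c *s x \<in> X" if x: "x \<in> X" for c x
  proof -
    obtain a s where "x = a + s" "a \<in> A" "s \<in> S" using x by (auto simp: X_def)
    then have "c *s x = c *s a + c *s s" "c *s a \<in> A" "c *s s \<in> S"
      using Ascl subS by (auto simp: scale_right_distrib subspace_scale)
    then show ?thesis unfolding X_def by blast
  qed
  define W where "W = (\<lambda>(x, y). x - y) ` (X \<times> X)"
  have subW: "subspace W"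
    unfolding W_def using fX AX A0 Xscl invX by (intro almost_invariant_imp_subspace) auto
  have "X \<subseteq> V" using sumV[OF SV] by (simp add: X_def)
  then have WV: "W \<subseteq> V" using V by (auto simp: W_def intro!: subspace_diff)
  have AW: "A \<subseteq> W"
  proof
    fix a assume "a \<in> A"
    then have "(a, 0) \<in> X \<times> X" using AX A0 by auto
    then show "a \<in> W" unfolding W_def by (rule rev_image_eqI) simp
  qed
  \<comment> \<open>An element of X - X is (x - y) + (s - t): the two vectors of A cost b each, the
    vector s - t of S costs \<open>b ^ m\<close>.\<close>
  have "b ^ (m + 2) * card V \<le> card (rad V w)" if w: "w \<in> W" for w
  proof -
    obtain x s y t where w: "w = (x + s) - (y + t)" "x \<in> A" "s \<in> S" "y \<in> A" "t \<in> S"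
      using w by (auto simp: W_def X_def)
    have "b * b * card V \<le> card (rad V (x - y))"
      using w b by (intro card_rad_add_ge[OF V, of _ _ x y] rad_Int_subset_diff) (auto simp: A_def)
    moreover have "s - t \<in> S" using w subS by (simp add: subspace_diff)
    then have "b ^ m * card V \<le> card (rad V (s - t))" by (rule radS)
    moreover have "w = (x - y) + (s - t)" using w by simp
    ultimately have "(b * b) * b ^ m * card V \<le> card (rad V w)"
      using b rad_Int_subset_add by (intro card_rad_add_ge[OF V, of "b * b" "b ^ m" "x - y" "s - t"]) auto
    then show ?thesis by (simp add: power_add power2_eq_square mult_ac)
  qed
  then show ?thesis using subW WV AW le[OF S] by blast
qed

text \<open>With b = \<epsilon> / 2, the set A and hence W have density at least b. On W the inverse
  densities of radicals are at most \<open>1 / b ^ (m + 2)\<close>, and making T vanish squares this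
  number. The exponent is therefore 1 + 2 (m + 2) = 2 m + 5. The density of A also bounds
  \<open>(6/5) ^ m\<close> by 1 / b, so m is logarithmic.\<close>

theorem biased_imp_vanishing_subspace:
  fixes \<epsilon> :: real
  assumes V: "subspace V" "finite V" and "\<epsilon> > 0"
    and bias: "\<epsilon> * (card V)\<^sup>2 \<le> card {(x, y). x \<in> V \<and> y \<in> V \<and> (\<forall>z\<in>V. T x y z = 0)}"
  shows "\<exists>U m. subspace U \<and> U \<subseteq> V \<and> card V \<le> (2 / \<epsilon>) ^ (2 * m + 5) * card U \<and>
           (6/5) ^ m \<le> 2 / \<epsilon> \<and> (\<forall>x\<in>U. \<forall>y\<in>U. \<forall>z\<in>U. T x y z = 0)"
proof -
  define b where "b = \<epsilon> / 2"
  define A where "A = {x \<in> V. b * card V \<le> card (rad V x)}"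
  have b0: "b > 0" using \<open>\<epsilon> > 0\<close> by (simp add: b_def)
  have "0 \<in> V" using V subspace_0 by blast
  then have posV: "card V > 0" using V by (auto simp: card_gt_0_iff)
  have fA: "finite A" and AV: "card A \<le> card V" using V by (auto simp: A_def intro!: card_mono)
  have rV: "card (rad V x) \<le> card V" for x using V rad_subset by (intro card_mono)
  have "\<epsilon> * (card V)\<^sup>2 \<le> (\<Sum>x\<in>V. real (card (rad V x)))"
    using bias by (simp add: card_zero_pairs V)
  \<comment> \<open>The x outside A contribute at most b \<open>card V\<close> each, in total at
    most half of the lower bound; A must supply the other half.\<close>
  also have "\<dots> \<le> (\<Sum>x\<in>V. (if x \<in> A then real (card V) else 0) + b * card V)"
    using rV b0 by (intro sum_mono) (auto simp: A_def add_increasing2)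
  also have "\<dots> = card A * card V + b * (card V)\<^sup>2"
    using V by (simp add: sum.distrib power2_eq_square A_def sum.If_cases Int_def)
  finally have "b * card V * card V \<le> card A * card V"
    by (simp add: b_def field_simps power2_eq_square)
  then have A: "b * card V \<le> card A" using posV by simp
  also have "\<dots> \<le> card V" using AV by simp
  finally have b1: "b \<le> 1" using posV by simp
  obtain W m where W: "subspace W" "W \<subseteq> V" "A \<subseteq> W" and m: "(6/5) ^ m * real (card A) \<le> card V"
    and rad: "\<And>x. x \<in> W \<Longrightarrow> b ^ (m + 2) * card V \<le> card (rad V x)"
    using dense_low_rank_imp_low_rank_subspace[OF V b0 b1 A_def] by blast
  have fW: "finite W" using W V finite_subset by blast
  \<comment> \<open>Restricting the form from V to W does not increase its rank, because
    \<open>rad V x \<inter> W\<close> lies in \<open>rad W x\<close>.\<close>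
  have "real (card W) \<le> (1 / b ^ (m + 2)) * card (rad W x)" if x: "x \<in> W" for x
  proof -
    have "rad V x \<inter> W \<subseteq> rad W x" using W by (auto simp: rad_def)
    then have 1: "card (rad V x \<inter> W) \<le> card (rad W x)"
      by (intro card_mono finite_rad fW)
    have "b ^ (m + 2) * card V * card W \<le> real (card (rad V x)) * card W"
      using rad[OF x] by (intro mult_right_mono) auto
    also have "\<dots> \<le> real (card V) * card (rad V x \<inter> W)"
      using card_subspaces_mult_le[OF V subspace_rad[OF V(1)] rad_subset W(1,2), of x]
      by (metis of_nat_le_iff of_nat_mult)
    also have "\<dots> \<le> real (card V) * card (rad W x)" using 1 by (intro mult_left_mono) auto
    finally have "b ^ (m + 2) * card W \<le> card (rad W x)" using posV by (simp add: mult_ac)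
    then show ?thesis using b0 by (simp add: field_simps)
  qed
  then obtain U where U: "subspace U" "U \<subseteq> W" "real (card W) \<le> (1 / b ^ (m + 2))\<^sup>2 * real (card U)"
    "\<forall>x\<in>U. \<forall>y\<in>U. \<forall>z\<in>U. T x y z = 0"
    using bounded_rank_imp_vanishing_subspace[OF W(1) fW, of "1 / b ^ (m + 2)"] b0 by auto
  have "card A \<le> card W" using W fW by (intro card_mono)
  then have "b * card V \<le> (1 / b ^ (m + 2))\<^sup>2 * real (card U)" using A U(3) by linarith
  then have "card V \<le> (1 / b ^ (m + 2))\<^sup>2 * real (card U) / b" using b0 by (simp add: field_simps)
  also have "\<dots> = (1 / b) ^ (2 * m + 5) * card U"
    using b0 by (simp add: power_add power_mult power2_eq_square field_simps eval_nat_numeral)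
  finally have "card V \<le> (2 / \<epsilon>) ^ (2 * m + 5) * card U" by (simp add: b_def)
  moreover have "(6/5) ^ m \<le> 2 / \<epsilon>"
  proof -
    have "(6/5) ^ m * (b * card V) \<le> (6/5) ^ m * card A" using A by (intro mult_left_mono) auto
    also note m
    finally have "(6/5) ^ m * b * card V \<le> card V" by (simp only: mult.assoc)
    then have "(6/5) ^ m * b \<le> 1" using posV by simp
    then show ?thesis using \<open>\<epsilon> > 0\<close> by (simp add: b_def field_simps)
  qed
  ultimately show ?thesis using U W(2) by blast
qed

text \<open>
  The set of all x with \<open>T x = 0\<close> and the radicals of all other \<open>T x\<close> are proper subspaces,
  hence contain at most half of the vectors.
\<close>

lemma card_zero_pairs_le:
  assumes V: "subspace V" "finite V" and nz: "x0 \<in> V" "y0 \<in> V" "z0 \<in> V" "T x0 y0 z0 \<noteq> 0"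
  shows "4 * card {(x, y). x \<in> V \<and> y \<in> V \<and> (\<forall>z\<in>V. T x y z = 0)} \<le> 3 * (card V)\<^sup>2"
proof -
  define Z where "Z = {x \<in> V. \<forall>y\<in>V. \<forall>z\<in>V. T x y z = 0}"
  have fin: "finite Z" using V by (simp add: Z_def)
  have "subspace Z"
    using V by (auto simp: Z_def subspace_def T_add T_scale)
  moreover have "x0 \<notin> Z" using nz by (auto simp: Z_def)
  then have "Z \<subset> V" using nz by (auto simp: Z_def)
  ultimately have Z: "2 * card Z \<le> card V" using card_proper_subspace_le_half V by blast
  have rV: "2 * card (rad V x) \<le> card V" if "x \<in> V - Z" for x
  proof -
    have "rad V x \<subset> V" using that by (auto simp: Z_def rad_def)
    then show ?thesis using card_proper_subspace_le_half[OF V subspace_rad[OF V(1)]] by blast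
  qed
  have "4 * card {(x, y). x \<in> V \<and> y \<in> V \<and> (\<forall>z\<in>V. T x y z = 0)} = 4 * (\<Sum>x\<in>V. card (rad V x))"
    by (simp add: card_zero_pairs V)
  also have "\<dots> = (\<Sum>x\<in>V. 4 * card (rad V x))" by (simp add: sum_distrib_left)
  also have "\<dots> \<le> (\<Sum>x\<in>V. 2 * card V + (if x \<in> Z then 2 * card V else 0))"
  proof (rule sum_mono)
    fix x assume x: "x \<in> V"
    show "4 * card (rad V x) \<le> 2 * card V + (if x \<in> Z then 2 * card V else 0)"
      using rV[of x] x card_mono[OF V(2) rad_subset, of x] by auto
  qed
  also have "\<dots> = 2 * card V * card V + card Z * (2 * card V)"
    using V by (simp add: sum.distrib Z_def sum.If_cases Int_def)
  also have "\<dots> \<le> 2 * card V * card V + card V * card V"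
    using Z by (metis add_left_mono mult.assoc mult.commute mult_le_mono1)
  finally show ?thesis by (simp add: power2_eq_square)
qed

end

section \<open>Iterated derivatives and polynomial degree\<close>

text \<open>Counterpart of \<open>add_derivative\<close> on a type that is a group. The type
  \<open>vec\<close> mixes lengths and is none, so vectors are replaced by functions on an index
  type below.\<close>

definition diff_by :: "'g::ab_group_add \<Rightarrow> ('g \<Rightarrow> 'a::ab_group_add) \<Rightarrow> 'g \<Rightarrow> 'a" where
  "diff_by y g = (\<lambda>x. g (x + y) - g x)"

text \<open>\<open>derivs_vanish (Suc d) g\<close> plays the role of "g has degree at most d"
  without choosing a polynomial. The index is one above the degree, so index 0 is left for the zero
  function.\<close>

primrec derivs_vanish :: "nat \<Rightarrow> ('g::ab_group_add \<Rightarrow> 'a::ab_group_add) \<Rightarrow> bool" where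
  "derivs_vanish 0 g \<longleftrightarrow> (\<forall>x. g x = 0)"
| "derivs_vanish (Suc k) g \<longleftrightarrow> (\<forall>y. derivs_vanish k (diff_by y g))"

lemma diff_by_zero [simp]: "diff_by y (\<lambda>_. 0) = (\<lambda>_. 0)"
  by (simp add: diff_by_def)

lemma derivs_vanish_zero [simp]: "derivs_vanish k (\<lambda>_. 0)"
  by (induction k) simp_all

lemma derivs_vanish_mono: "derivs_vanish k g \<Longrightarrow> k \<le> l \<Longrightarrow> derivs_vanish l g"
proof (induction k arbitrary: g l)
  case 0
  then have "g = (\<lambda>_. 0)" by auto
  then show ?case by simp
next
  case (Suc k)
  then obtain l' where "l = Suc l'" "k \<le> l'" by (cases l) auto
  with Suc show ?case by simp
qed

lemma derivs_vanish_const: "derivs_vanish (Suc k) (\<lambda>_. c)"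
  by (simp add: diff_by_def)

lemma derivs_vanish_additive:
  assumes "\<And>x y. l (x + y) = l x + l y"
  shows "derivs_vanish (Suc (Suc 0)) l"
  by (simp add: assms diff_by_def)

lemma derivs_vanish_add:
  "derivs_vanish k g \<Longrightarrow> derivs_vanish k h \<Longrightarrow> derivs_vanish k (\<lambda>x. g x + h x)"
proof (induction k arbitrary: g h)
  case (Suc k)
  have "diff_by y (\<lambda>x. g x + h x) = (\<lambda>x. diff_by y g x + diff_by y h x)" for y
    by (simp add: diff_by_def fun_eq_iff)
  with Suc show ?case by simp
qed simp

lemma derivs_vanish_sum:
  "(\<And>i. i \<in> I \<Longrightarrow> derivs_vanish k (g i)) \<Longrightarrow> derivs_vanish k (\<lambda>x. \<Sum>i\<in>I. g i x)"
  by (induction I rule: infinite_finite_induct) (simp_all add: derivs_vanish_add)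

text \<open>A difference of g h is a sum of three products, in each of which at least one factor has
  been differenced. The indices being degrees plus one, adding degrees means a + b - 1 for the
  product.\<close>

lemma derivs_vanish_mult:
  fixes g h :: "'g::ab_group_add \<Rightarrow> 'a::comm_ring"
  shows "derivs_vanish a g \<Longrightarrow> derivs_vanish b h \<Longrightarrow> a + b \<le> Suc k \<Longrightarrow>
    derivs_vanish k (\<lambda>x. g x * h x)"
proof (induction k arbitrary: a b g h)
  case 0
  then have "a = 0 \<or> b = 0" by auto
  with 0 show ?case by auto
next
  case (Suc k)
  show ?case
  proof (cases "a = 0 \<or> b = 0")
    case True
    then have "(\<lambda>x. g x * h x) = (\<lambda>_. 0)" using Suc.prems by auto
    then show ?thesis by (metis derivs_vanish_zero)
  next
    case False
    then obtain a' b' where ab: "a = Suc a'" "b = Suc b'" by (metis not0_implies_Suc)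
    have "diff_by y (\<lambda>x. g x * h x) =
        (\<lambda>x. diff_by y g x * h x + (diff_by y g x * diff_by y h x + g x * diff_by y h x))" for y
      by (simp add: diff_by_def algebra_simps)
    moreover have "derivs_vanish k (\<lambda>x. diff_by y g x * h x)" for y
      using Suc.prems ab by (intro Suc.IH[of a' _ b]) auto
    moreover have "derivs_vanish k (\<lambda>x. diff_by y g x * diff_by y h x)" for y
      using Suc.prems ab by (intro Suc.IH[of a' _ b']) auto
    moreover have "derivs_vanish k (\<lambda>x. g x * diff_by y h x)" for y
      using Suc.prems ab by (intro Suc.IH[of a _ b']) auto
    ultimately show ?thesis by (auto intro!: derivs_vanish_add)
  qed
qed

lemma derivs_vanish_cmult:
  fixes g :: "'g::ab_group_add \<Rightarrow> 'a::comm_ring"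
  shows "derivs_vanish k g \<Longrightarrow> derivs_vanish k (\<lambda>x. c * g x)"
  using derivs_vanish_mult[OF derivs_vanish_const[of 0 c], of k g k] by simp

lemma derivs_vanish_prod:
  fixes g :: "'i \<Rightarrow> 'g::ab_group_add \<Rightarrow> 'a::comm_ring_1"
  assumes "\<And>i. i \<in> I \<Longrightarrow> derivs_vanish (Suc (d i)) (g i)"
  shows "derivs_vanish (Suc (\<Sum>i\<in>I. d i)) (\<lambda>x. \<Prod>i\<in>I. g i x)"
  using assms
proof (induction I rule: infinite_finite_induct)
  case (insert i I)
  then show ?case by (auto intro!: derivs_vanish_mult[of "Suc (d i)" _ "Suc (sum d I)"] simp del: derivs_vanish.simps)
qed (simp_all add: derivs_vanish_const del: derivs_vanish.simps)

lemma derivs_vanish_power: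
  fixes g :: "'g::ab_group_add \<Rightarrow> 'a::comm_ring_1"
  assumes "derivs_vanish (Suc (Suc 0)) g"
  shows "derivs_vanish (Suc e) (\<lambda>x. g x ^ e)"
  using derivs_vanish_prod[of "{..<e}" "\<lambda>_. 1" "\<lambda>_. g"] assms by simp

lemma derivs_vanish_compose:
  assumes P: "\<And>x y. P (x + y) = P x + P y"
  shows "derivs_vanish k g \<Longrightarrow> derivs_vanish k (\<lambda>x. g (P x))"
proof (induction k arbitrary: g)
  case (Suc k)
  have "diff_by y (\<lambda>x. g (P x)) = (\<lambda>x. diff_by (P y) g (P x))" for y
    by (simp add: diff_by_def P)
  with Suc show ?case by simp
qed simp

text \<open>The truncated subtraction is meant: from j = k on, the iterated difference is
  identically zero.\<close>

lemma derivs_vanish_funpow: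
  "derivs_vanish k g \<Longrightarrow> derivs_vanish (k - j) ((diff_by e ^^ j) g)"
proof (induction j arbitrary: k g)
  case (Suc j)
  have "derivs_vanish (k - 1) (diff_by e g)"
  proof (cases k)
    case 0
    then have "g = (\<lambda>_. 0)" using Suc.prems by auto
    then show ?thesis by simp
  qed (use Suc.prems in auto)
  then have "derivs_vanish (k - 1 - j) ((diff_by e ^^ j) (diff_by e g))" by (rule Suc.IH)
  then show ?case by (simp add: funpow_swap1)
qed simp

section \<open>Newton's forward difference formula over a prime field\<close>

definition scale_fun :: "'a::times \<Rightarrow> ('i \<Rightarrow> 'a) \<Rightarrow> 'i \<Rightarrow> 'a" where
  "scale_fun c x = (\<lambda>i. c * x i)"

interpretation fun_space: vector_space "scale_fun :: 'a::field \<Rightarrow> ('i \<Rightarrow> 'a) \<Rightarrow> 'i \<Rightarrow> 'a"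
  by unfold_locales (auto simp: scale_fun_def fun_eq_iff algebra_simps)

text \<open>Induction on t for all g at once, by Pascal's rule. Any number N > t of terms will do,
  since the binomial coefficients beyond t are zero.\<close>

lemma newton_forward_nat:
  fixes g :: "('i \<Rightarrow> 'a::comm_ring_1) \<Rightarrow> 'a"
  assumes "t < N"
  shows "g (x + scale_fun (of_nat t) e) = (\<Sum>k<N. of_nat (t choose k) * (diff_by e ^^ k) g x)"
  using assms
proof (induction t arbitrary: g)
  case 0
  have "scale_fun 0 e = 0" by (simp add: scale_fun_def fun_eq_iff)
  moreover obtain M where "N = Suc M" using 0 by (cases N) auto
  ultimately show ?case by (simp add: sum.lessThan_Suc_shift del: sum.lessThan_Suc)
next
  case (Suc t)
  obtain M where N: "N = Suc M" using Suc.prems by (cases N) auto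
  have eq: "x + scale_fun (of_nat (Suc t)) e = (x + scale_fun (of_nat t) e) + e"
    by (simp add: scale_fun_def fun_eq_iff algebra_simps)
  have "g (x + scale_fun (of_nat (Suc t)) e) =
      g (x + scale_fun (of_nat t) e) + diff_by e g (x + scale_fun (of_nat t) e)"
    unfolding eq by (simp add: diff_by_def)
  also have "\<dots> = (\<Sum>k<N. of_nat (t choose k) * (diff_by e ^^ k) g x)
      + (\<Sum>k<N. of_nat (t choose k) * (diff_by e ^^ k) (diff_by e g) x)"
    using Suc.prems by (simp only: Suc.IH[of g, OF Suc_lessD] Suc.IH[of "diff_by e g", OF Suc_lessD])
  \<comment> \<open>The top term drops out because t < M; what remains is indexed so that Pascal's
    rule applies after a shift.\<close>
  also have "(\<Sum>k<N. of_nat (t choose k) * (diff_by e ^^ k) (diff_by e g) x)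
      = (\<Sum>k<M. of_nat (t choose k) * (diff_by e ^^ Suc k) g x)"
    using Suc.prems by (simp add: N funpow_swap1 binomial_eq_0)
  also have "(\<Sum>k<N. of_nat (t choose k) * (diff_by e ^^ k) g x) + \<dots>
      = (\<Sum>k<N. of_nat (Suc t choose k) * (diff_by e ^^ k) g x)"
    by (simp add: N sum.lessThan_Suc_shift sum.distrib algebra_simps
        del: funpow.simps sum.lessThan_Suc)
  finally show ?case .
qed

lemma Suc_times_binomial_Suc: "Suc k * (t choose Suc k) = (t - k) * (t choose k)"
  by (metis binomial_absorb_comp binomial_absorption)

text \<open>With the factorial multiplied out, no division occurs and any commutative ring is
  allowed; for t < k both sides are 0.\<close>

lemma fact_times_binomial:
  "(of_nat (fact k * (t choose k)) :: 'a::comm_ring_1) = (\<Prod>i<k. of_nat t - of_nat i)"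
proof (induction k)
  case (Suc k)
  have "fact (Suc k) * (t choose Suc k) = (t - k) * (fact k * (t choose k))"
  proof -
    have "fact (Suc k) * (t choose Suc k) = fact k * (Suc k * (t choose Suc k))"
      by (simp only: fact_Suc mult_ac of_nat_id)
    then show ?thesis by (simp only: Suc_times_binomial_Suc mult_ac)
  qed
  moreover have "(of_nat ((t - k) * (fact k * (t choose k))) :: 'a) =
      (of_nat t - of_nat k) * of_nat (fact k * (t choose k))"
    by (cases "k \<le> t") (auto simp: of_nat_diff binomial_eq_0)
  ultimately show ?case using Suc by (simp only: prod.lessThan_Suc mult.commute)
qed simp

lemma of_nat_mod_ring_eq_0_iff:
  "(of_nat k :: 'p::prime_card mod_ring) = 0 \<longleftrightarrow> CARD('p) dvd k"
  by (simp add: of_nat_eq_0_iff_char_dvd)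

lemma mod_ring_eq_of_nat:
  obtains t where "t < CARD('p)" "(u :: 'p::prime_card mod_ring) = of_nat t"
proof
  have "to_int_mod_ring u \<in> {0..<int CARD('p)}" using range_to_int_mod_ring[where ?'a = 'p] by blast
  then have 1: "nat (to_int_mod_ring u) < CARD('p)" "int (nat (to_int_mod_ring u)) = to_int_mod_ring u"
    by auto
  show "nat (to_int_mod_ring u) < CARD('p)" by (rule 1)
  show "u = of_nat (nat (to_int_mod_ring u))"
    using 1(2) by (simp add: of_nat_of_int_mod_ring)
qed

text \<open>The binomial coefficient "u choose k" as a polynomial in u. Over the field with p
  elements it is meaningful for k < p, where \<open>fact k\<close> is invertible.\<close>

definition falling_binomial :: "nat \<Rightarrow> 'a::field \<Rightarrow> 'a" where
  "falling_binomial k u = (\<Prod>i<k. u - of_nat i) / of_nat (fact k)"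

lemma of_nat_binomial_mod_ring:
  assumes "k < CARD('p)"
  shows "(of_nat (t choose k) :: 'p::prime_card mod_ring) = falling_binomial k (of_nat t)"
proof -
  have "(of_nat (fact k) :: 'p mod_ring) \<noteq> 0"
    using assms by (simp add: of_nat_mod_ring_eq_0_iff prime_dvd_fact_iff prime_card not_le del: of_nat_fact)
  then show ?thesis
    using fact_times_binomial[of k t, where ?'a = "'p mod_ring"]
    by (simp add: falling_binomial_def field_simps del: of_nat_fact)
qed

text \<open>Every scalar is \<open>of_nat t\<close> for some t < p, so p terms suffice, and for k <
  p the coefficients are polynomials in u.\<close>

lemma newton_forward:
  fixes g :: "('i \<Rightarrow> 'p::prime_card mod_ring) \<Rightarrow> 'p mod_ring"
  shows "g (x + scale_fun u e) = (\<Sum>k<CARD('p). falling_binomial k u * (diff_by e ^^ k) g x)"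
proof -
  obtain t where t: "t < CARD('p)" "u = of_nat t" by (rule mod_ring_eq_of_nat)
  show ?thesis
    using newton_forward_nat[OF t(1), of g x e]
    by (simp add: t(2) of_nat_binomial_mod_ring cong: sum.cong_simp)
qed

section \<open>From vanishing derivatives to polynomials of bounded degree, and back\<close>

definition monomial_fun :: "(nat \<Rightarrow>\<^sub>0 nat) \<Rightarrow> (nat \<Rightarrow> 'a::comm_semiring_1) \<Rightarrow> 'a" where
  "monomial_fun m u = (\<Prod>i\<in>Poly_Mapping.keys m. u i ^ Poly_Mapping.lookup m i)"

definition monomial_degree :: "(nat \<Rightarrow>\<^sub>0 nat) \<Rightarrow> nat" where
  "monomial_degree m = (\<Sum>i\<in>Poly_Mapping.keys m. Poly_Mapping.lookup m i)"

definition coords :: "nat \<Rightarrow> 'a::zero vec \<Rightarrow> nat \<Rightarrow> 'a" where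
  "coords n x i = (if i < n then x $ i else 0)"

text \<open>The bound is strict, so that k = 0 leaves the zero function only, as for \<^const>\<open>derivs_vanish\<close>.\<close>

definition represented :: "nat \<Rightarrow> nat \<Rightarrow> ((nat \<Rightarrow> 'a::comm_semiring_1) \<Rightarrow> 'a) \<Rightarrow> bool" where
  "represented n k h \<longleftrightarrow> (\<exists>P\<in>multipolys n.
     (\<forall>m\<in>Poly_Mapping.keys P. monomial_degree m < k) \<and>
     (\<forall>x\<in>carrier_vec n. multipoly_eval P x = h (coords n x)))"

lemma monomial_fun_superset:
  assumes "finite S" "Poly_Mapping.keys m \<subseteq> S"
  shows "monomial_fun m u = (\<Prod>i\<in>S. u i ^ Poly_Mapping.lookup m i)"
  unfolding monomial_fun_def using assms
  by (intro prod.mono_neutral_left) (auto simp: in_keys_iff)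

lemma monomial_degree_superset:
  assumes "finite S" "Poly_Mapping.keys m \<subseteq> S"
  shows "monomial_degree m = (\<Sum>i\<in>S. Poly_Mapping.lookup m i)"
  unfolding monomial_degree_def using assms
  by (intro sum.mono_neutral_left) (auto simp: in_keys_iff)

lemma
  fixes u :: "nat \<Rightarrow> 'a::comm_semiring_1"
  shows monomial_fun_add_single:
      "monomial_fun (m + Poly_Mapping.single j 1) u = u j * monomial_fun m u"
    and monomial_degree_add_single:
      "monomial_degree (m + Poly_Mapping.single j 1) = Suc (monomial_degree m)"
proof -
  let ?S = "insert j (Poly_Mapping.keys m)"
  have S: "finite ?S" "Poly_Mapping.keys m \<subseteq> ?S"
    "Poly_Mapping.keys (m + Poly_Mapping.single j 1) \<subseteq> ?S"
    using Poly_Mapping.keys_add[of m "Poly_Mapping.single j 1"] by (auto split: if_splits)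
  have "(\<Prod>i\<in>?S. u i ^ Poly_Mapping.lookup (Poly_Mapping.single j 1) i) = (\<Prod>i\<in>?S. if i = j then u j else 1)"
    by (intro prod.cong) (auto simp: lookup_single)
  then show "monomial_fun (m + Poly_Mapping.single j 1) u = u j * monomial_fun m u"
    using S by (simp only: monomial_fun_superset[of ?S] lookup_add power_add prod.distrib prod.delta)
      (simp add: mult.commute)
  have "(\<Sum>i\<in>?S. Poly_Mapping.lookup (Poly_Mapping.single j 1) i) = (\<Sum>i\<in>?S. if i = j then 1 else 0::nat)"
    by (intro sum.cong) (auto simp: lookup_single)
  then show "monomial_degree (m + Poly_Mapping.single j 1) = Suc (monomial_degree m)"
    using S by (simp only: monomial_degree_superset[of ?S] lookup_add sum.distrib sum.delta) simp
qed

lemma multipoly_eval_superset: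
  assumes "finite S" "Poly_Mapping.keys P \<subseteq> S"
  shows "multipoly_eval P x = (\<Sum>m\<in>S. Poly_Mapping.lookup P m * monomial_fun m (\<lambda>i. x $ i))"
  unfolding multipoly_eval_def monomial_fun_def using assms
  by (intro sum.mono_neutral_left) (auto simp: in_keys_iff)

lemma multipoly_eval_add: "multipoly_eval (P + Q) x = multipoly_eval P x + multipoly_eval Q x"
proof -
  let ?S = "Poly_Mapping.keys P \<union> Poly_Mapping.keys Q"
  have S: "finite ?S" "Poly_Mapping.keys (P + Q) \<subseteq> ?S" using Poly_Mapping.keys_add[of P Q] by auto
  show ?thesis
    using S by (simp add: multipoly_eval_superset[of ?S] lookup_add sum.distrib distrib_right)
qed

lemma represented_zero: "represented n k (\<lambda>_. 0)"
  unfolding represented_def by (intro bexI[of _ 0]) (auto simp: multipolys_def multipoly_eval_def)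

lemma represented_mono: "represented n k h \<Longrightarrow> k \<le> l \<Longrightarrow> represented n l h"
  unfolding represented_def by (meson order_less_le_trans)

lemma represented_add:
  assumes "represented n k g" "represented n k h"
  shows "represented n k (\<lambda>u. g u + h u)"
proof -
  obtain P Q where "P \<in> multipolys n" "\<forall>m\<in>Poly_Mapping.keys P. monomial_degree m < k"
    "\<forall>x\<in>carrier_vec n. multipoly_eval P x = g (coords n x)"
    "Q \<in> multipolys n" "\<forall>m\<in>Poly_Mapping.keys Q. monomial_degree m < k"
    "\<forall>x\<in>carrier_vec n. multipoly_eval Q x = h (coords n x)"
    using assms unfolding represented_def by blast
  with Poly_Mapping.keys_add[of P Q] show ?thesis
    unfolding represented_def by (intro bexI[of _ "P + Q"]) (fastforce simp: multipoly_eval_add multipolys_def)+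
qed

lemma represented_sum:
  "(\<And>i. i \<in> I \<Longrightarrow> represented n k (h i)) \<Longrightarrow> represented n k (\<lambda>u. \<Sum>i\<in>I. h i u)"
  by (induction I rule: infinite_finite_induct) (auto simp: represented_zero represented_add)

lemma monomial_fun_coords:
  assumes "Poly_Mapping.keys m \<subseteq> {..<n}"
  shows "monomial_fun m (coords n x) = monomial_fun m (\<lambda>i. x $ i)"
  unfolding monomial_fun_def using assms by (intro prod.cong) (auto simp: coords_def)

lemma represented_monomial:
  assumes "Poly_Mapping.keys m \<subseteq> {..<n}" "monomial_degree m < k"
  shows "represented n k (\<lambda>u. c * monomial_fun m u)"
  unfolding represented_def using assms
  by (intro bexI[of _ "Poly_Mapping.single m c"])
    (auto simp: multipolys_def monomial_fun_coords multipoly_eval_superset[of "{m}"] split: if_splits)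

lemma represented_monomial_sum:
  assumes "represented n k h"
  obtains S a where "finite S" "\<And>m. m \<in> S \<Longrightarrow> Poly_Mapping.keys m \<subseteq> {..<n}"
    "\<And>m. m \<in> S \<Longrightarrow> monomial_degree m < k"
    "\<And>x. x \<in> carrier_vec n \<Longrightarrow> h (coords n x) = (\<Sum>m\<in>S. a m * monomial_fun m (coords n x))"
proof -
  obtain P where P: "P \<in> multipolys n" "\<forall>m\<in>Poly_Mapping.keys P. monomial_degree m < k"
    "\<forall>x\<in>carrier_vec n. multipoly_eval P x = h (coords n x)"
    using assms unfolding represented_def by blast
  show thesis
  proof (rule that[of "Poly_Mapping.keys P" "Poly_Mapping.lookup P"])
    show "h (coords n x) = (\<Sum>m\<in>Poly_Mapping.keys P. Poly_Mapping.lookup P m * monomial_fun m (coords n x))"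
      if "x \<in> carrier_vec n" for x
      using P that by (auto simp: multipolys_def monomial_fun_coords
          multipoly_eval_superset[of "Poly_Mapping.keys P"] intro!: sum.cong)
  qed (use P in \<open>auto simp: multipolys_def\<close>)
qed

lemma represented_cmult:
  assumes "represented n k h"
  shows "represented n k (\<lambda>u. c * h u)"
proof -
  obtain S a where S: "finite S" "\<And>m. m \<in> S \<Longrightarrow> Poly_Mapping.keys m \<subseteq> {..<n}"
    "\<And>m. m \<in> S \<Longrightarrow> monomial_degree m < k"
    "\<And>x. x \<in> carrier_vec n \<Longrightarrow> h (coords n x) = (\<Sum>m\<in>S. a m * monomial_fun m (coords n x))"
    using assms by (rule represented_monomial_sum) blast
  have "represented n k (\<lambda>u. \<Sum>m\<in>S. (c * a m) * monomial_fun m u)"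
    using S by (intro represented_sum represented_monomial) auto
  then show ?thesis
    unfolding represented_def by (auto simp: S(4) sum_distrib_left mult.assoc)
qed

lemma represented_times_coord:
  assumes "represented n k h" "i < n"
  shows "represented n (Suc k) (\<lambda>u. u i * h u)"
proof -
  obtain S a where S: "finite S" "\<And>m. m \<in> S \<Longrightarrow> Poly_Mapping.keys m \<subseteq> {..<n}"
    "\<And>m. m \<in> S \<Longrightarrow> monomial_degree m < k"
    "\<And>x. x \<in> carrier_vec n \<Longrightarrow> h (coords n x) = (\<Sum>m\<in>S. a m * monomial_fun m (coords n x))"
    using assms by (rule_tac represented_monomial_sum) auto
  have "Poly_Mapping.keys (m + Poly_Mapping.single i 1) \<subseteq> {..<n}" if "m \<in> S" for m
    using S(2)[OF that] assms(2) Poly_Mapping.keys_add[of m "Poly_Mapping.single i 1"]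
    by (auto split: if_splits)
  then have "represented n (Suc k) (\<lambda>u. \<Sum>m\<in>S. a m * monomial_fun (m + Poly_Mapping.single i 1) u)"
    using S by (intro represented_sum represented_monomial) (auto simp only: monomial_degree_add_single Suc_less_eq)
  then show ?thesis
    unfolding represented_def by (simp add: S(4) sum_distrib_left mult_ac monomial_fun_add_single[of _ i, unfolded One_nat_def])
qed

lemma represented_times_falling_binomial:
  assumes "represented n k h" "i < n"
  shows "represented n (k + j) (\<lambda>u. falling_binomial j (u i) * h u)"
proof -
  have "represented n (k + j) (\<lambda>u. (\<Prod>l<j. u i - of_nat l) * h u)"
  proof (induction j)
    case (Suc j)
    let ?F = "\<lambda>u. (\<Prod>l<j. u i - of_nat l) * h u"
    have "represented n (Suc (k + j)) (\<lambda>u. u i * ?F u + (- of_nat j) * ?F u)"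
      using Suc assms(2)
      by (intro represented_add represented_times_coord represented_mono[OF represented_cmult[OF Suc]]) auto
    then show ?case
      by (simp add: algebra_simps)
  qed (use assms in simp)
  from represented_cmult[OF this, of "1 / of_nat (fact j)"] show ?thesis
    by (simp add: falling_binomial_def)
qed

text \<open>Induction on the number m of active variables, expanding by Newton's formula in the last
  of them. The j-th difference lowers the index by j, and its coefficient, of degree j in that
  variable, restores it. Terms with j > k vanish.\<close>

lemma derivs_vanish_imp_represented_truncated:
  fixes g :: "(nat \<Rightarrow> 'p::prime_card mod_ring) \<Rightarrow> 'p mod_ring"
  assumes "derivs_vanish k g" "m \<le> n"
  shows "represented n k (\<lambda>u. g (\<lambda>i. if i < m then u i else 0))"
  using assms
proof (induction m arbitrary: k g)
  case 0
  show ?case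
  proof (cases k)
    case 0
    then show ?thesis using "0.prems" by (simp add: represented_zero)
  next
    case (Suc k')
    then show ?thesis
      using represented_monomial[of 0 n k "g (\<lambda>_. 0)"]
      by (simp add: monomial_fun_def monomial_degree_def)
  qed
next
  case (Suc m)
  define Z where "Z = (\<lambda>u :: nat \<Rightarrow> 'p mod_ring. \<lambda>i. if i < m then u i else 0)"
  define e :: "nat \<Rightarrow> 'p mod_ring" where "e = (\<lambda>i. if i = m then 1 else 0)"
  have split: "(\<lambda>i. if i < Suc m then u i else 0) = Z u + scale_fun (u m) e" for u
    by (auto simp: Z_def e_def scale_fun_def fun_eq_iff less_Suc_eq)
  have "represented n k (\<lambda>u. falling_binomial j (u m) * (diff_by e ^^ j) g (Z u))" for j
  proof (cases "j \<le> k")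
    case True
    have "represented n (k - j) (\<lambda>u. (diff_by e ^^ j) g (Z u))"
      unfolding Z_def using Suc.prems by (intro Suc.IH derivs_vanish_funpow) auto
    then show ?thesis
      using represented_times_falling_binomial[of n "k - j" _ m j] Suc.prems True by simp
  next
    case False
    then have "derivs_vanish 0 ((diff_by e ^^ j) g)"
      using derivs_vanish_funpow[OF Suc.prems(1), of j e] by simp
    then show ?thesis by (simp add: represented_zero)
  qed
  then show ?case
    unfolding split newton_forward by (intro represented_sum)
qed

lemma derivs_vanish_imp_multipoly:
  fixes g :: "(nat \<Rightarrow> 'p::prime_card mod_ring) \<Rightarrow> 'p mod_ring"
  assumes "derivs_vanish (Suc d) g"
  obtains P where "P \<in> multipolys n" "fun_degree n (multipoly_eval P) \<le> d"
    "\<And>x. x \<in> carrier_vec n \<Longrightarrow> multipoly_eval P x = g (coords n x)"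
proof -
  have "represented n (Suc d) (\<lambda>u. g (\<lambda>i. if i < n then u i else 0))"
    using derivs_vanish_imp_represented_truncated[OF assms order_refl] .
  moreover have "(\<lambda>i. if i < n then coords n x i else 0) = coords n x" for x :: "'p mod_ring vec"
    by (auto simp: coords_def fun_eq_iff)
  ultimately obtain P where P: "P \<in> multipolys n" "\<forall>m\<in>Poly_Mapping.keys P. monomial_degree m < Suc d"
    "\<And>x. x \<in> carrier_vec n \<Longrightarrow> multipoly_eval P x = g (coords n x)"
    unfolding represented_def by auto
  have "fun_degree n (multipoly_eval P) \<le> total_degree P"
    unfolding fun_degree_def using P(1) by (intro Least_le) auto
  also have "\<dots> \<le> d"
    using P(2) unfolding total_degree_def monomial_degree_def by (auto simp: less_Suc_eq_le)
  finally show thesis using P that by blast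
qed

text \<open>Coordinates are additive and so have index 2; the product and sum rules do the rest.
  Composition with \<open>vec n\<close> moves the domain to a group.\<close>

lemma derivs_vanish_multipoly_eval:
  fixes P :: "'a::comm_ring_1 multipoly"
  assumes "P \<in> multipolys n"
  shows "derivs_vanish (Suc (total_degree P)) (\<lambda>u. multipoly_eval P (vec n u))"
proof -
  have keys: "Poly_Mapping.keys m \<subseteq> {..<n}" if "m \<in> Poly_Mapping.keys P" for m
    using assms that by (auto simp: multipolys_def)
  have coord: "derivs_vanish (Suc (Suc 0)) (\<lambda>u :: nat \<Rightarrow> 'a. vec n u $ i)" if "i < n" for i
    using that by (intro derivs_vanish_additive) auto
  have mono: "derivs_vanish (Suc (\<Sum>i\<in>Poly_Mapping.keys m. Poly_Mapping.lookup m i))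
      (\<lambda>u :: nat \<Rightarrow> 'a. \<Prod>i\<in>Poly_Mapping.keys m. (vec n u $ i) ^ Poly_Mapping.lookup m i)"
    if "m \<in> Poly_Mapping.keys P" for m
    using keys[OF that] by (intro derivs_vanish_prod derivs_vanish_power coord) auto
  have le: "(\<Sum>i\<in>Poly_Mapping.keys m. Poly_Mapping.lookup m i) \<le> total_degree P"
    if "m \<in> Poly_Mapping.keys P" for m
    using that unfolding total_degree_def by (intro Max_ge) auto
  show ?thesis
    unfolding multipoly_eval_def
    by (intro derivs_vanish_sum derivs_vanish_cmult derivs_vanish_mono[OF mono]) (auto simp: le)
qed

text \<open>The previous bound is applied to a representative of least total degree instead of f
  itself.\<close>

lemma derivs_vanish_fun_degree:
  fixes f :: "'a::comm_ring_1 multipoly"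
  assumes "f \<in> multipolys n"
  shows "derivs_vanish (Suc (fun_degree n (multipoly_eval f))) (\<lambda>u. multipoly_eval f (vec n u))"
proof -
  have "\<exists>d. \<exists>P\<in>multipolys n. (\<forall>x\<in>carrier_vec n. multipoly_eval P x = multipoly_eval f x) \<and> total_degree P = d"
    using assms by blast
  then have "\<exists>P\<in>multipolys n. (\<forall>x\<in>carrier_vec n. multipoly_eval P x = multipoly_eval f x) \<and>
      total_degree P = fun_degree n (multipoly_eval f)"
    unfolding fun_degree_def by (rule LeastI_ex)
  then obtain P where P: "P \<in> multipolys n" "total_degree P = fun_degree n (multipoly_eval f)"
    "\<And>x. x \<in> carrier_vec n \<Longrightarrow> multipoly_eval P x = multipoly_eval f x" by blast
  have "(\<lambda>u. multipoly_eval P (vec n u)) = (\<lambda>u. multipoly_eval f (vec n u))"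
    using P(3) by auto
  with derivs_vanish_multipoly_eval[OF P(1)] P(2) show ?thesis by simp
qed

lemma fun_degree_cong:
  assumes "\<And>x. x \<in> carrier_vec n \<Longrightarrow> f x = g x"
  shows "fun_degree n f = fun_degree n g"
  unfolding fun_degree_def using assms by (metis (no_types, lifting))

section \<open>Splitting off linear factors\<close>

text \<open>This turns an index of subspaces back into a codimension, hence into a number of linear
  factors.\<close>

lemma (in vector_space) card_span_independent:
  assumes "finite (UNIV :: 'a set)" "finite B" "independent B"
  shows "card (span B) = CARD('a) ^ card B"
  using assms(2,3)
proof (induction B rule: finite_induct)
  case (insert b B)
  then have b: "b \<notin> span B" and B: "independent B" by (auto simp: independent_insert)
  let ?h = "\<lambda>(k, x). scale k b + x"
  have "span (insert b B) = ?h ` (UNIV \<times> span B)"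
  proof (intro equalityI subsetI)
    fix v assume "v \<in> span (insert b B)"
    then obtain k where "v - scale k b \<in> span B" by (auto simp: span_breakdown_eq)
    then show "v \<in> ?h ` (UNIV \<times> span B)"
      by (intro image_eqI[of _ _ "(k, v - scale k b)"]) auto
  next
    fix v assume "v \<in> ?h ` (UNIV \<times> span B)"
    then obtain k x where "v = scale k b + x" "x \<in> span B" by auto
    then have "v - scale k b \<in> span B" by simp
    then show "v \<in> span (insert b B)" by (auto simp: span_breakdown_eq)
  qed
  moreover have "inj_on ?h (UNIV \<times> span B)"
  proof (rule inj_onI, clarify)
    fix k x k' x'
    assume x: "x \<in> span B" "x' \<in> span B" and eq: "scale k b + x = scale k' b + x'"
    then have diff: "scale (k - k') b = x' - x" by (simp add: scale_left_diff_distrib algebra_simps)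
    have "k = k'"
    proof (rule ccontr)
      assume "k \<noteq> k'"
      then have "b = scale (inverse (k - k')) (x' - x)" by (simp flip: diff)
      with x b show False by (metis span_diff span_scale)
    qed
    with eq show "k = k' \<and> x = x'" by simp
  qed
  ultimately have "card (span (insert b B)) = CARD('a) * card (span B)"
    by (simp add: card_image card_cartesian_product)
  with insert.IH[OF B] insert.hyps show ?case by simp
qed simp

text \<open>A basis A of U is extended to a basis B of V. The vectors e j enumerate B - A, the l j
  are their coordinates, and P is the projection to U along them. All of this is asserted on V only,
  the span of B.\<close>

lemma (in vector_space) subspace_complement_coordinates:
  assumes fin: "finite (UNIV :: 'a set)" and U: "subspace U" "U \<subseteq> V" and V: "subspace V" "finite V"
  obtains c e l P where
    "CARD('a) ^ c * card U = card V"
    "\<And>j x y. j < c \<Longrightarrow> x \<in> V \<Longrightarrow> y \<in> V \<Longrightarrow> l j (x + y) = l j x + l j y"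
    "\<And>x y. x \<in> V \<Longrightarrow> y \<in> V \<Longrightarrow> P (x + y) = P x + P y"
    "\<And>x. x \<in> V \<Longrightarrow> P x \<in> U"
    "\<And>x. x \<in> V \<Longrightarrow> x = P x + (\<Sum>j<c. scale (l j x) (e j))"
proof -
  obtain A where A: "A \<subseteq> U" "independent A" "U \<subseteq> span A" by (rule maximal_independent_subset)
  obtain B where B: "A \<subseteq> B" "B \<subseteq> V" "independent B" "V \<subseteq> span B"
    using maximal_independent_subset_extend[of A V] A U by blast
  have spans: "span A = U" "span B = V"
    using span_minimal[of A U] span_minimal[of B V] A B U V by simp_all
  have fB: "finite B" by (rule finite_subset[OF B(2) V(2)])
  then have fA: "finite A" by (rule finite_subset[OF B(1)])
  define c where "c = card (B - A)"
  obtain e where e: "bij_betw e {..<c} (B - A)"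
    using ex_bij_betw_nat_finite[of "B - A"] fB by (auto simp: c_def atLeast0LessThan)
  define l where "l = (\<lambda>j x. representation B x (e j))"
  define P where "P = (\<lambda>x. \<Sum>b\<in>A. scale (representation B x b) b)"
  have rep_add: "representation B (x + y) b = representation B x b + representation B y b"
    if "x \<in> V" "y \<in> V" for x y b
    using representation_add[OF B(3), of y x] that spans by simp
  show thesis
  proof (rule that[of c l P e])
    have "card B = c + card A" using B(1) fA fB by (simp add: c_def card_Diff_subset card_mono)
    then show "CARD('a) ^ c * card U = card V"
      using card_span_independent[OF fin fA A(2)] card_span_independent[OF fin fB B(3)] spans by (metis power_add)
    show "l j (x + y) = l j x + l j y" if "x \<in> V" "y \<in> V" for j x y
      using rep_add that by (simp add: l_def)
    show "P (x + y) = P x + P y" if "x \<in> V" "y \<in> V" for x y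
      using rep_add that by (simp add: P_def scale_left_distrib sum.distrib)
    show "P x \<in> U" if "x \<in> V" for x
      unfolding P_def using A U by (intro subspace_sum subspace_scale) auto
    show "x = P x + (\<Sum>j<c. scale (l j x) (e j))" if "x \<in> V" for x
    proof -
      have "x = (\<Sum>b\<in>B. scale (representation B x b) b)"
        using sum_representation_eq[OF B(3), of x B] that spans fB by simp
      also have "\<dots> = P x + (\<Sum>b\<in>B - A. scale (representation B x b) b)"
        using sum.subset_diff[OF B(1) fB] by (simp add: P_def add.commute)
      also have "(\<Sum>b\<in>B - A. scale (representation B x b) b) = (\<Sum>j<c. scale (l j x) (e j))"
        using sum.reindex_bij_betw[OF e, of "\<lambda>b. scale (representation B x b) b"] by (simp add: l_def)
      finally show ?thesis .
    qed
  qed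
qed

text \<open>
  Every term of the Newton expansion of \<open>g (P x + l x e)\<close> with a positive index carries
  a factor \<open>l x\<close>, and the cofactor has degree one less than g.
\<close>

lemma derivs_vanish_increment:
  fixes g :: "('i \<Rightarrow> 'p::prime_card mod_ring) \<Rightarrow> 'p mod_ring"
  assumes g: "derivs_vanish (Suc k) g"
    and P: "\<And>x y. P (x + y) = P x + P y" and l: "\<And>x y. l (x + y) = l x + l y"
  obtains q where "derivs_vanish k q" "\<And>x. g (P x + scale_fun (l x) e) = g (P x) + l x * q x"
proof -
  \<comment> \<open>\<open>falling_binomial (Suc j)\<close> with its factor u removed, which leaves
    degree j.\<close>
  define r where "r j u = (\<Prod>i<j. u - of_nat (Suc i)) / of_nat (fact (Suc j))" for j and u :: "'p mod_ring"
  define D where "D j = (diff_by e ^^ j) g" for j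
  define q where "q x = (\<Sum>j<CARD('p) - 1. r j (l x) * D (Suc j) (P x))" for x
  have card: "CARD('p) = Suc (CARD('p) - 1)" by simp
  have fb: "falling_binomial (Suc j) u = u * r j u" for j and u :: "'p mod_ring"
    unfolding falling_binomial_def r_def prod.lessThan_Suc_shift by simp
  have "g (P x + scale_fun (l x) e) = g (P x) + l x * q x" for x
  proof -
    have "g (P x + scale_fun (l x) e) = (\<Sum>j<Suc (CARD('p) - 1). falling_binomial j (l x) * D j (P x))"
      unfolding newton_forward D_def using card by simp
    also have "\<dots> = g (P x) + (\<Sum>j<CARD('p) - 1. falling_binomial (Suc j) (l x) * D (Suc j) (P x))"
      unfolding sum.lessThan_Suc_shift by (simp add: D_def falling_binomial_def)
    also have "\<dots> = g (P x) + l x * q x" by (simp add: fb q_def sum_distrib_left mult.assoc)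
    finally show ?thesis .
  qed
  moreover have "derivs_vanish k q"
  proof -
    have "derivs_vanish k (\<lambda>x. r j (l x) * D (Suc j) (P x))" for j
    proof (cases "j \<le> k")
      case True
      have "derivs_vanish (Suc (Suc 0)) (\<lambda>x. l x - of_nat (Suc i))" for i
        using derivs_vanish_add[OF derivs_vanish_additive[of l, OF l] derivs_vanish_const[of "Suc 0" "- of_nat (Suc i)"]]
        by (simp only: add_uminus_conv_diff)
      then have "derivs_vanish (Suc (\<Sum>i<j. Suc 0)) (\<lambda>x. \<Prod>i<j. l x - of_nat (Suc i))"
        by (intro derivs_vanish_prod)
      then have "derivs_vanish (Suc j) (\<lambda>x. (1 / of_nat (fact (Suc j))) * (\<Prod>i<j. l x - of_nat (Suc i)))"
        by (intro derivs_vanish_cmult) simp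
      then have "derivs_vanish (Suc j) (\<lambda>x. r j (l x))" by (simp only: r_def mult_1_left times_divide_eq_left)
      \<comment> \<open>The indices Suc j and k - j add up to Suc k, which is just enough for a
        product of index k.\<close>
      moreover have "derivs_vanish (Suc k - Suc j) (\<lambda>x. D (Suc j) (P x))"
        unfolding D_def by (rule derivs_vanish_compose[OF P derivs_vanish_funpow[OF g]])
      ultimately show ?thesis by (rule derivs_vanish_mult) (use True in simp)
    next
      case False
      then have "derivs_vanish 0 (D (Suc j))"
        using derivs_vanish_funpow[OF g, of "Suc j" e] by (simp add: D_def)
      then show ?thesis by simp
    qed
    then show ?thesis unfolding q_def by (intro derivs_vanish_sum)
  qed
  ultimately show thesis using that by blast
qed

text \<open>The directions e j are added one at a time: P together with the first c of them is again
  an additive map, and \<open>derivs_vanish_increment\<close> splits off the next product.\<close>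

lemma derivs_vanish_decomposition:
  fixes g :: "('i \<Rightarrow> 'p::prime_card mod_ring) \<Rightarrow> 'p mod_ring" and c :: nat
  assumes g: "derivs_vanish (Suc k) g"
    and P: "\<And>x y. P (x + y) = P x + P y" and l: "\<And>j x y. j < c \<Longrightarrow> l j (x + y) = l j x + l j y"
  shows "\<exists>q. (\<forall>j<c. derivs_vanish k (q j)) \<and>
    (\<forall>x. g (P x + (\<Sum>j<c. scale_fun (l j x) (e j))) = g (P x) + (\<Sum>j<c. l j x * q j x))"
  using l
proof (induction c)
  case 0
  show ?case by simp
next
  case (Suc c)
  have "\<And>j x y. j < c \<Longrightarrow> l j (x + y) = l j x + l j y" by (rule Suc.prems) simp
  from Suc.IH[OF this] obtain q where q: "\<forall>j<c. derivs_vanish k (q j)"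
    "\<And>x. g (P x + (\<Sum>j<c. scale_fun (l j x) (e j))) = g (P x) + (\<Sum>j<c. l j x * q j x)"
    by blast
  define P' where "P' x = P x + (\<Sum>j<c. scale_fun (l j x) (e j))" for x
  have "P' (x + y) = P' x + P' y" for x y
    using Suc.prems by (simp add: P'_def P fun_space.scale_left_distrib sum.distrib)
  then obtain q' where q': "derivs_vanish k q'"
    "\<And>x. g (P' x + scale_fun (l c x) (e c)) = g (P' x) + l c x * q' x"
    using derivs_vanish_increment[OF g, of P' "l c" "e c"] Suc.prems by blast
  have "g (P x + (\<Sum>j<Suc c. scale_fun (l j x) (e j))) =
      g (P x) + (\<Sum>j<Suc c. l j x * (q(c := q')) j x)" for x
    using q'(2)[of x] q(2)[of x] by (simp add: P'_def add.assoc)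
  moreover have "\<forall>j<Suc c. derivs_vanish k ((q(c := q')) j)"
    using q(1) q'(1) by (simp add: less_Suc_eq)
  ultimately show ?case by blast
qed

section \<open>The Gowers norm of a cubic\<close>

lemma add_character_eq_cis:
  "add_character (a :: 'p::prime_card mod_ring) = cis (2 * pi * to_int_mod_ring a / CARD('p))"
proof -
  have "exp (2 * of_real pi * \<i> / of_nat CARD('p)) = cis (2 * pi / CARD('p))"
    by (simp add: cis_conv_exp mult_ac)
  then show ?thesis
    by (simp add: add_character_def cis_power_int mult_ac)
qed

lemma cis_two_pi_times_int_div_mod:
  assumes "n > 0"
  shows "cis (2 * pi * of_int (k mod int n) / n) = cis (2 * pi * of_int k / n)"
proof -
  have "real_of_int k = real_of_int (k mod int n) + real n * of_int (k div int n)"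
    by (metis add.commute mult_div_mod_eq of_int_add of_int_mult of_int_of_nat_eq)
  then have "2 * pi * of_int k / n = 2 * pi * of_int (k mod int n) / n + 2 * pi * of_int (k div int n)"
    using assms by (simp add: field_simps)
  moreover have "cis (2 * pi * of_int (k div int n)) = 1"
    by (rule cis_multiple_2pi) simp
  ultimately show ?thesis by (simp flip: cis_mult)
qed

lemma add_character_add:
  "add_character (a + b) = add_character a * add_character (b :: 'p::prime_card mod_ring)"
proof -
  have "to_int_mod_ring (a + b) = (to_int_mod_ring a + to_int_mod_ring b) mod int CARD('p)"
    by transfer simp
  then have "add_character (a + b) = cis (2 * pi * of_int (to_int_mod_ring a + to_int_mod_ring b) / CARD('p))"
    by (simp only: add_character_eq_cis cis_two_pi_times_int_div_mod zero_less_card_finite)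
  then show ?thesis
    by (simp add: add_character_eq_cis cis_mult add_divide_distrib distrib_left)
qed

lemma add_character_eq_1_iff: "add_character a = 1 \<longleftrightarrow> (a :: 'p::prime_card mod_ring) = 0"
proof
  assume "add_character a = 1"
  then have "cos (2 * pi * to_int_mod_ring a / CARD('p)) = 1"
    unfolding add_character_eq_cis by (metis cis.simps(1) one_complex.simps(1))
  then obtain i :: int where "2 * pi * to_int_mod_ring a / CARD('p) = of_int i * 2 * pi"
    by (auto simp: cos_one_2pi_int)
  then have "real_of_int (to_int_mod_ring a) = real_of_int (i * int CARD('p))"
    by (simp add: field_simps)
  then have eq: "to_int_mod_ring a = i * int CARD('p)" by linarith
  have "to_int_mod_ring a \<in> {0..<int CARD('p)}"
    using range_to_int_mod_ring[where ?'a = 'p] by blast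
  then have "to_int_mod_ring a mod int CARD('p) = to_int_mod_ring a" by simp
  with eq have "to_int_mod_ring a = 0" by simp
  then show "a = 0" by simp
qed (simp add: add_character_def)

text \<open>Translating by some z0 with nonzero \<phi> z0 permutes V and multiplies the sum by a
  number other than 1.\<close>

lemma sum_add_character:
  fixes \<phi> :: "'g::ab_group_add \<Rightarrow> 'p::prime_card mod_ring"
  assumes \<phi>: "\<And>x y. \<phi> (x + y) = \<phi> x + \<phi> y"
    and V: "\<And>x y. x \<in> V \<Longrightarrow> y \<in> V \<Longrightarrow> x + y \<in> V" "\<And>x. x \<in> V \<Longrightarrow> - x \<in> V"
  shows "(\<Sum>z\<in>V. add_character (\<phi> z)) = (if \<forall>z\<in>V. \<phi> z = 0 then of_nat (card V) else 0)"
proof (cases "\<forall>z\<in>V. \<phi> z = 0")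
  case True
  then have "(\<Sum>z\<in>V. add_character (\<phi> z)) = (\<Sum>z\<in>V. 1)"
    by (intro sum.cong) (auto simp: add_character_eq_1_iff)
  with True show ?thesis by simp
next
  case False
  then obtain z0 where z0: "z0 \<in> V" "\<phi> z0 \<noteq> 0" by blast
  have "z - z0 \<in> V" if "z \<in> V" for z
    using V(1)[OF that V(2)[OF z0(1)]] by simp
  then have "bij_betw (\<lambda>z. z0 + z) V V"
    using V z0(1) by (intro bij_betw_byWitness[of _ "\<lambda>z. z - z0"]) auto
  then have "(\<Sum>z\<in>V. add_character (\<phi> z)) = (\<Sum>z\<in>V. add_character (\<phi> (z0 + z)))"
    by (simp only: sum.reindex_bij_betw[of "\<lambda>z. z0 + z" V V "\<lambda>z. add_character (\<phi> z)"])
  also have "\<dots> = add_character (\<phi> z0) * (\<Sum>z\<in>V. add_character (\<phi> z))"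
    by (simp add: \<phi> add_character_add sum_distrib_left)
  finally have "(1 - add_character (\<phi> z0)) * (\<Sum>z\<in>V. add_character (\<phi> z)) = 0"
    by (simp add: algebra_simps)
  then show ?thesis using z0 False by (auto simp: add_character_eq_1_iff)
qed

text \<open>In a prime field every scalar is a multiple of 1, so additive maps are linear.\<close>

lemma additive_scale_fun:
  fixes \<phi> :: "('i \<Rightarrow> 'p::prime_card mod_ring) \<Rightarrow> 'p mod_ring"
  assumes \<phi>: "\<And>x y. \<phi> (x + y) = \<phi> x + \<phi> y"
  shows "\<phi> (scale_fun c x) = c * \<phi> x"
proof -
  obtain t where c: "c = of_nat t" by (rule mod_ring_eq_of_nat)
  have 0: "\<phi> 0 = 0" using \<phi>[of 0 0] by (metis add_0 add_cancel_right_left)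
  have "\<phi> (scale_fun (of_nat t) x) = of_nat t * \<phi> x"
  proof (induction t)
    case 0
    then show ?case using \<open>\<phi> 0 = 0\<close> by (simp only: of_nat_0 fun_space.scale_zero_left mult_zero_left)
  next
    case (Suc t)
    have "\<phi> (scale_fun (of_nat (Suc t)) x) = \<phi> (x + scale_fun (of_nat t) x)"
      by (simp only: of_nat_Suc fun_space.scale_left_distrib fun_space.scale_one)
    then show ?case using Suc by (simp only: \<phi> of_nat_Suc distrib_right mult_1_left)
  qed
  then show ?thesis by (simp only: c)
qed

text \<open>The base point 0 is arbitrary once the fourth derivatives of g vanish.\<close>

definition third_derivative :: "('g::ab_group_add \<Rightarrow> 'a::ab_group_add) \<Rightarrow> 'g \<Rightarrow> 'g \<Rightarrow> 'g \<Rightarrow> 'a" where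
  "third_derivative g x y z = diff_by z (diff_by y (diff_by x g)) 0"

lemma diff_by_commute: "diff_by x (diff_by y g) = diff_by y (diff_by x g)"
  by (simp add: diff_by_def fun_eq_iff algebra_simps)

lemma third_derivative_eq:
  assumes "derivs_vanish 4 g"
  shows "diff_by z (diff_by y (diff_by x g)) w = third_derivative g x y z"
proof -
  have "diff_by w (diff_by z (diff_by y (diff_by x g))) 0 = 0"
    using assms by (simp add: eval_nat_numeral)
  then show ?thesis by (simp add: third_derivative_def diff_by_def[of w])
qed

text \<open>A difference in direction x + x' is one in direction x plus one in direction x' at a
  shifted base point, and the base point does not matter. Symmetry is commutation of
  differences.\<close>

lemma symmetric_trilinear_third_derivative:
  fixes g :: "('i \<Rightarrow> 'p::prime_card mod_ring) \<Rightarrow> 'p mod_ring"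
  assumes g: "derivs_vanish 4 g"
  shows "symmetric_trilinear scale_fun (third_derivative g)"
proof -
  have add: "third_derivative g (x + x') y z = third_derivative g x y z + third_derivative g x' y z" for x x' y z
  proof -
    have "third_derivative g (x + x') y z =
        diff_by z (diff_by y (diff_by x g)) 0 + diff_by z (diff_by y (diff_by x' g)) x"
      by (simp add: third_derivative_def diff_by_def add_ac)
    then show ?thesis by (simp only: third_derivative_eq[OF g])
  qed
  show ?thesis
  proof
    show "third_derivative g (scale_fun c x) y z = c * third_derivative g x y z" for c x y z
      using additive_scale_fun[of "\<lambda>x. third_derivative g x y z"] add by blast
    show "third_derivative g x y z = third_derivative g y x z" for x y z
      by (simp only: third_derivative_def diff_by_commute[of x])
    show "third_derivative g x y z = third_derivative g x z y" for x y z
      by (simp only: third_derivative_def diff_by_commute[of y])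
  qed (rule add)
qed

section \<open>The copy of \<open>carrier_vec n\<close> among functions, and the norm computed
  there\<close>

definition coord_space :: "nat \<Rightarrow> (nat \<Rightarrow> 'a::zero) set" where
  "coord_space n = {u. \<forall>i\<ge>n. u i = 0}"

lemma subspace_coord_space: "fun_space.subspace (coord_space n)"
  by (auto simp: fun_space.subspace_def coord_space_def scale_fun_def)

lemma vec_coords: "x \<in> carrier_vec n \<Longrightarrow> vec n (coords n x) = x"
  by (auto simp: coords_def)

lemma coords_vec: "u \<in> coord_space n \<Longrightarrow> coords n (vec n u) = u"
  by (auto simp: coords_def coord_space_def fun_eq_iff not_less)

lemma coords_in_coord_space: "coords n x \<in> coord_space n"
  by (auto simp: coords_def coord_space_def)

lemma vec_plus_fun: "vec n (u + v) = vec n u + vec n v"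
  by (rule eq_vecI) auto

lemma bij_betw_vec_coord_space: "bij_betw (vec n) (coord_space n) (carrier_vec n)"
  by (rule bij_betw_byWitness[of _ "coords n"]) (auto simp: vec_coords coords_vec coords_in_coord_space)

lemma finite_coord_space: "finite (coord_space n :: (nat \<Rightarrow> 'a::{zero,finite}) set)"
  using finite_set_of_finite_funs[of "{..<n}" "UNIV :: 'a set" 0]
  by (rule rev_finite_subset) (auto simp: coord_space_def)

lemma fold_add_derivative_eq_third_derivative:
  fixes f :: "'a::ab_group_add vec \<Rightarrow> 'a"
  assumes "derivs_vanish 4 (\<lambda>u. f (vec n u))" "x \<in> carrier_vec n"
  shows "fold add_derivative [vec n u, vec n v, vec n w] f x = third_derivative (\<lambda>u. f (vec n u)) u v w"
proof -
  have "fold add_derivative [vec n u, vec n v, vec n w] f x =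
      diff_by w (diff_by v (diff_by u (\<lambda>u. f (vec n u)))) (coords n x)"
    using assms(2) by (simp add: add_derivative_def diff_by_def vec_plus_fun vec_coords)
  then show ?thesis by (simp only: third_derivative_eq[OF assms(1)])
qed

text \<open>The summand does not depend on the base point, and summing over the third direction w
  gives \<open>card V\<close> if v lies in the radical of \<open>T u\<close> and 0 otherwise. The
  average is thus the density of the zero pairs, a nonnegative real, so that taking its absolute
  value changes nothing.\<close>

lemma gowers_norm_3_pow_8:
  fixes f :: "'p::prime_card mod_ring vec \<Rightarrow> 'p mod_ring" and n :: nat
  defines "g \<equiv> \<lambda>u. f (vec n u)" and "V \<equiv> coord_space n"
  assumes g: "derivs_vanish 4 g"
  shows "gowers_norm n 3 f \<ge> 0"
    and "gowers_norm n 3 f ^ 8 * (card V)\<^sup>2 =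
      card {(x, y). x \<in> V \<and> y \<in> V \<and> (\<forall>z\<in>V. third_derivative g x y z = 0)}"
proof -
  let ?T = "third_derivative g"
  let ?L = "{ys :: 'p mod_ring vec list. length ys = 3 \<and> set ys \<subseteq> carrier_vec n}"
  let ?C = "carrier_vec n :: 'p mod_ring vec set"
  let ?Z = "{(x, y). x \<in> V \<and> y \<in> V \<and> (\<forall>z\<in>V. ?T x y z = 0)}"
  interpret T: symmetric_trilinear scale_fun ?T
    using g by (rule symmetric_trilinear_third_derivative)
  have V: "fun_space.subspace V" "finite V"
    unfolding V_def by (simp_all add: subspace_coord_space finite_coord_space)
  have pos: "card V > 0" using V fun_space.subspace_0[OF V(1)] by (auto simp: card_gt_0_iff)
  have cardV: "card ?C = card V"
    unfolding V_def using bij_betw_same_card[OF bij_betw_vec_coord_space] by metis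
  define \<beta> where "\<beta> = (\<lambda>(u, v, w). [vec n u, vec n v, vec n w :: 'p mod_ring vec])"
  have \<beta>: "bij_betw \<beta> (V \<times> V \<times> V) ?L"
  proof (rule bij_betw_byWitness[of _ "\<lambda>ys. (coords n (ys ! 0), coords n (ys ! 1), coords n (ys ! 2))"])
    show "\<forall>ys\<in>?L. \<beta> (coords n (ys ! 0), coords n (ys ! 1), coords n (ys ! 2)) = ys"
      by (auto simp: \<beta>_def vec_coords length_Suc_conv eval_nat_numeral)
  qed (auto simp: \<beta>_def V_def coords_vec coords_in_coord_space)
  have cardL: "card ?L = card V ^ 3"
    using bij_betw_same_card[OF \<beta>] by (simp add: card_cartesian_product power3_eq_cube)
  have "(\<Sum>(x, ys)\<in>?C \<times> ?L. add_character (fold add_derivative ys f x))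
      = (\<Sum>x\<in>?C. \<Sum>ys\<in>?L. add_character (fold add_derivative ys f x))"
    by (simp add: sum.cartesian_product)
  also have "\<dots> = (\<Sum>x\<in>?C. \<Sum>(u, v, w)\<in>V \<times> V \<times> V. add_character (?T u v w))"
  proof (rule sum.cong[OF refl])
    fix x assume x: "x \<in> ?C"
    show "(\<Sum>ys\<in>?L. add_character (fold add_derivative ys f x)) =
        (\<Sum>(u, v, w)\<in>V \<times> V \<times> V. add_character (?T u v w))"
      unfolding sum.reindex_bij_betw[OF \<beta>, symmetric]
      using fold_add_derivative_eq_third_derivative[of f n x] g x
      by (intro sum.cong) (auto simp: \<beta>_def g_def)
  qed
  also have "(\<Sum>(u, v, w)\<in>V \<times> V \<times> V. add_character (?T u v w)) =
      (\<Sum>u\<in>V. \<Sum>v\<in>V. \<Sum>w\<in>V. add_character (?T u v w))"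
    by (simp add: sum.cartesian_product)
  also have "\<dots> = (\<Sum>u\<in>V. \<Sum>v\<in>V. if v \<in> T.rad V u then of_nat (card V) else 0)"
    using V by (intro sum.cong) (auto simp: sum_add_character T.T_add3 fun_space.subspace_add fun_space.subspace_neg T.rad_def)
  also have "\<dots> = (\<Sum>u\<in>V. of_nat (card (T.rad V u)) * of_nat (card V))"
    using V T.rad_subset by (intro sum.cong) (auto simp: sum.If_cases Int_absorb1)
  also have "\<dots> = of_nat (card ?Z) * of_nat (card V)"
    by (simp add: T.card_zero_pairs[OF V(2)] sum_distrib_right)
  finally have sum: "(\<Sum>(x, ys)\<in>?C \<times> ?L. add_character (fold add_derivative ys f x)) =
      of_nat (card V * card V * card ?Z)"
    by (simp add: cardV mult_ac)
  have "gowers_norm n 3 f = root 8 (cmod (of_nat (card V * card V * card ?Z) / of_nat (card V * card V ^ 3)))"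
    unfolding gowers_norm_def Let_def sum by (simp add: card_cartesian_product cardV cardL)
  also have "\<dots> = root 8 (card ?Z / (card V)\<^sup>2)"
    using pos by (simp add: norm_divide norm_mult norm_power power3_eq_cube power2_eq_square)
  finally have eq: "gowers_norm n 3 f = root 8 (card ?Z / (card V)\<^sup>2)" .
  show "gowers_norm n 3 f \<ge> 0" unfolding eq by simp
  show "gowers_norm n 3 f ^ 8 * (card V)\<^sup>2 = card ?Z"
    unfolding eq using pos by (simp add: real_root_pow_pos2)
qed

section \<open>Cubics of large norm\<close>

text \<open>In terms of N, the binary logarithm of 2 / \<delta> ^ 8, m is O(N) and c is O(N m + N).
  The gap \<delta> ^ 8 \<le> 3/4 keeps ln (1 / \<delta>) away from 0, so it absorbs all additive
  constants.\<close>

lemma log_squared_bound: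
  fixes \<delta> :: real
  assumes \<delta>: "\<delta> > 0" "\<delta> ^ 8 \<le> 3/4"
    and c: "2 ^ c \<le> (2 / \<delta> ^ 8) ^ (2 * m + 5)" and m: "(6/5) ^ m \<le> 2 / \<delta> ^ 8"
  shows "real (c + 1) \<le> 14 * (32 / ln 2)\<^sup>2 * (ln (1 / \<delta>))\<^sup>2"
proof -
  define L where "L = ln (1 / \<delta>)"
  define N where "N = ln (2 / \<delta> ^ 8) / ln 2"
  have ln2: "ln (2::real) > 0" by simp
  have NL: "N * ln 2 = ln 2 + 8 * L"
    using \<delta>(1) by (simp add: N_def L_def ln_div ln_realpow)
  have "ln (4/3) \<le> ln (1 / \<delta> ^ 8)"
    using \<delta> by (subst ln_le_cancel_iff) (auto simp: field_simps)
  then have L1: "ln (4/3) \<le> 8 * L"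
    using \<delta>(1) by (simp add: L_def ln_div ln_realpow)
  \<comment> \<open>As the cube of 4/3 exceeds 2, ln 2 is at most 24 L, and ln 2 + 8 L at most 32
    L.\<close>
  have "ln 2 \<le> ln ((4/3)^3 :: real)" by (subst ln_le_cancel_iff) (auto simp: eval_nat_numeral)
  also have "\<dots> = 3 * ln (4/3)" by (simp add: ln_realpow)
  finally have "N * ln 2 \<le> 32 * L" using NL L1 by linarith
  then have N_le: "N \<le> 32 / ln 2 * L" using ln2 by (simp add: field_simps)
  have "ln (4/3::real) \<ge> 0" by (rule ln_ge_zero) simp
  then have "ln 2 \<le> N * ln 2" using NL L1 by linarith
  then have N1: "N \<ge> 1" using ln2 by simp
  have pos: "2 / \<delta> ^ 8 > 0" using \<delta>(1) by simp
  have "real m * ln (6/5) = ln ((6/5) ^ m)" by (simp add: ln_realpow)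
  also have "\<dots> \<le> ln (2 / \<delta> ^ 8)" using m pos by (subst ln_le_cancel_iff) auto
  also have "\<dots> = N * ln 2" using ln2 by (simp add: N_def)
  finally have m1: "real m * ln (6/5) \<le> N * ln 2" .
  \<comment> \<open>The fourth power of 6/5 exceeds 2, which gives the 4 in
    \<open>m \<le> 4 * N\<close>.\<close>
  have "ln 2 \<le> ln ((6/5)^4 :: real)" by (subst ln_le_cancel_iff) (auto simp: eval_nat_numeral)
  also have "\<dots> = 4 * ln (6/5)" by (simp add: ln_realpow)
  finally have "real m * ln 2 \<le> real m * (4 * ln (6/5))" by (rule mult_left_mono) simp
  then have "real m * ln 2 \<le> (4 * N) * ln 2" using m1 by linarith
  then have m_le: "real m \<le> 4 * N" using ln2 by simp
  have "real c * ln 2 = ln (2 ^ c)" by (simp add: ln_realpow)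
  also have "\<dots> \<le> ln ((2 / \<delta> ^ 8) ^ (2 * m + 5))" using c pos by (subst ln_le_cancel_iff) auto
  also have "\<dots> = real (2 * m + 5) * ln (2 / \<delta> ^ 8)" using pos by (simp only: ln_realpow)
  also have "\<dots> = (2 * real m + 5) * N * ln 2" using ln2 by (simp add: N_def)
  finally have "real c \<le> (2 * real m + 5) * N" using ln2 by simp
  also have "\<dots> \<le> (8 * N + 5) * N" using m_le N1 by (intro mult_right_mono) auto
  finally have "real (c + 1) \<le> 8 * (N * N) + 5 * N + 1" by (simp add: algebra_simps)
  \<comment> \<open>14 = 8 + 5 + 1, because N \<ge> 1.\<close>
  also have "\<dots> \<le> 14 * (N * N)"
  proof -
    have "N * 1 \<le> N * N" using N1 by (intro mult_left_mono) auto
    then show ?thesis using N1 by linarith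
  qed
  also have "\<dots> \<le> 14 * ((32 / ln 2 * L) * (32 / ln 2 * L))"
    using N_le N1 by (intro mult_left_mono mult_mono) auto
  finally show ?thesis by (simp add: L_def power2_eq_square mult_ac)
qed

theorem theorem2:
  "\<exists>C::real. C > 0 \<and>
     (\<forall>(n::nat) (f :: 'p::prime_card mod_ring multipoly) (\<delta>::real).
        f \<in> multipolys n \<longrightarrow>
        fun_degree n (multipoly_eval f) = 3 \<longrightarrow>
        gowers_norm n 3 (multipoly_eval f) = \<delta> \<longrightarrow>
        (\<exists>(c::nat) (q :: nat \<Rightarrow> 'p mod_ring multipoly) (l :: nat \<Rightarrow> 'p mod_ring multipoly).
           real (c + 1) \<le> C * (ln (1 / \<delta>))\<^sup>2 \<and>
           (\<forall>j \<in> {0..c}. q j \<in> multipolys n \<and> fun_degree n (multipoly_eval (q j)) \<le> 2) \<and>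
           (\<forall>j \<in> {1..c}. l j \<in> multipolys n \<and> fun_degree n (multipoly_eval (l j)) \<le> 1) \<and>
           (\<forall>x \<in> carrier_vec n.
              multipoly_eval f x =
                (\<Sum>j = 1..c. multipoly_eval (l j) x * multipoly_eval (q j) x)
                  + multipoly_eval (q 0) x)))"
proof (intro exI[of _ "14 * (32 / ln 2)\<^sup>2"] conjI allI impI)
  show "14 * (32 / ln 2)\<^sup>2 > (0::real)" by simp
next
  fix n :: nat and f :: "'p mod_ring multipoly" and \<delta> :: real
  assume f: "f \<in> multipolys n" "fun_degree n (multipoly_eval f) = 3"
    and norm: "gowers_norm n 3 (multipoly_eval f) = \<delta>"
  define g where "g = (\<lambda>u. multipoly_eval f (vec n u))"
  define V :: "(nat \<Rightarrow> 'p mod_ring) set" where "V = coord_space n"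
  \<comment> \<open>The function g is defined on all sequences but sees only the first n entries; tr
    truncates to these, moving every argument into V, where the linear algebra takes place.\<close>
  define tr :: "(nat \<Rightarrow> 'p mod_ring) \<Rightarrow> nat \<Rightarrow> 'p mod_ring" where "tr u = coords n (vec n u)" for u
  let ?T = "third_derivative g"
  have g4: "derivs_vanish 4 g"
    using derivs_vanish_fun_degree[OF f(1)] f(2) by (simp add: g_def eval_nat_numeral)
  interpret T: symmetric_trilinear scale_fun ?T
    using g4 by (rule symmetric_trilinear_third_derivative)
  have V: "fun_space.subspace V" "finite V"
    unfolding V_def by (simp_all add: subspace_coord_space finite_coord_space)
  have vec_tr: "vec n (tr u) = vec n u" for u
    unfolding tr_def by (rule vec_coords) simp
  have trV: "tr u \<in> V" for u by (simp add: tr_def V_def coords_in_coord_space)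
  have tr_add: "tr (u + v) = tr u + tr v" for u v
    by (auto simp: tr_def coords_def fun_eq_iff)
  have g_tr: "g (tr u) = g u" for u by (simp add: g_def vec_tr)
  have g_coords: "g (coords n x) = multipoly_eval f x" if "x \<in> carrier_vec n" for x
    using that by (simp add: g_def vec_coords)
  have T_tr: "?T (tr x) (tr y) (tr z) = ?T x y z" for x y z
    by (simp add: third_derivative_def diff_by_def g_def vec_plus_fun vec_tr)

  \<comment> \<open>Degree exactly 3 is used here: otherwise f would have a representative of degree
    at most 2. So T is not zero, and the norm stays away from 1.\<close>
  have "\<not> derivs_vanish 3 g"
  proof
    assume "derivs_vanish 3 g"
    then have "derivs_vanish (Suc 2) g" by (simp only: eval_nat_numeral)
    then obtain P where P: "P \<in> multipolys n" "fun_degree n (multipoly_eval P) \<le> 2"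
      "\<And>x. x \<in> carrier_vec n \<Longrightarrow> multipoly_eval P x = g (coords n x)"
      by (rule derivs_vanish_imp_multipoly[where n = n]) blast
    have "fun_degree n (multipoly_eval P) = fun_degree n (multipoly_eval f)"
      by (rule fun_degree_cong) (simp add: P(3) g_coords)
    with P(2) f(2) show False by simp
  qed
  then obtain x0 y0 z0 w0 where "diff_by z0 (diff_by y0 (diff_by x0 g)) w0 \<noteq> 0"
    by (auto simp: eval_nat_numeral)
  then have nz: "?T (tr x0) (tr y0) (tr z0) \<noteq> 0"
    by (simp only: third_derivative_eq[OF g4] T_tr not_False_eq_True)

  let ?Z = "{(x, y). x \<in> V \<and> y \<in> V \<and> (\<forall>z\<in>V. ?T x y z = 0)}"
  have gn: "\<delta> \<ge> 0" "\<delta> ^ 8 * (card V)\<^sup>2 = card ?Z"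
    using gowers_norm_3_pow_8[of "multipoly_eval f" n] g4 norm by (simp_all add: g_def V_def)
  have V0: "0 \<in> V" using V fun_space.subspace_0 by blast
  then have posV: "card V > 0" using V(2) by (auto simp: card_gt_0_iff)
  \<comment> \<open>The pair (0, 0) is always counted, hence \<delta> > 0 and ln (1 / \<delta>) is
    meaningful.\<close>
  have "finite ?Z" using V(2) by (intro finite_subset[of ?Z "V \<times> V"]) auto
  moreover have "(0, 0) \<in> ?Z" using V0 by simp
  ultimately have "card ?Z > 0" unfolding card_gt_0_iff by blast
  then have "\<delta> ^ 8 * (card V)\<^sup>2 > 0" using gn(2) by simp
  then have "\<delta> ^ 8 > 0" using posV by (simp add: zero_less_mult_iff)
  then have \<delta>0: "\<delta> > 0" using gn(1) by (cases "\<delta> = 0") auto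
  have "4 * real (card ?Z) \<le> 3 * (real (card V))\<^sup>2"
    using T.card_zero_pairs_le[OF V trV trV trV nz, THEN of_nat_mono[where ?'a = real]]
    by (simp only: of_nat_mult of_nat_numeral of_nat_power)
  then have \<delta>34: "\<delta> ^ 8 \<le> 3/4" using posV by (simp flip: gn(2))

  obtain U m where U: "fun_space.subspace U" "U \<subseteq> V" "card V \<le> (2 / \<delta> ^ 8) ^ (2 * m + 5) * card U"
    and m: "(6/5) ^ m \<le> 2 / \<delta> ^ 8" and TU: "\<forall>x\<in>U. \<forall>y\<in>U. \<forall>z\<in>U. ?T x y z = 0"
    using T.biased_imp_vanishing_subspace[OF V \<open>\<delta> ^ 8 > 0\<close>] gn(2) by auto
  obtain c e l P where c: "CARD('p mod_ring) ^ c * card U = card V"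
    and l: "\<And>j x y. j < c \<Longrightarrow> x \<in> V \<Longrightarrow> y \<in> V \<Longrightarrow> l j (x + y) = l j x + l j y"
    and P: "\<And>x y. x \<in> V \<Longrightarrow> y \<in> V \<Longrightarrow> P (x + y) = P x + P y" "\<And>x. x \<in> V \<Longrightarrow> P x \<in> U"
    and dec: "\<And>x. x \<in> V \<Longrightarrow> x = P x + (\<Sum>j<c. scale_fun (l j x) (e j))"
    by (rule fun_space.subspace_complement_coordinates[OF finite[of UNIV] U(1,2) V]) (rule that)
  have "card U > 0"
    using c posV by (metis mult_0_right neq0_conv)
  \<comment> \<open>Weakening p to 2 makes the constant independent of the field.\<close>
  have "2 ^ c \<le> real (CARD('p)) ^ c"
    using prime_ge_2_nat[OF prime_card[where ?'a = 'p]] by (intro power_mono) auto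
  moreover have "real (CARD('p)) ^ c * card U \<le> (2 / \<delta> ^ 8) ^ (2 * m + 5) * card U"
    using U(3) by (simp flip: c)
  then have "real (CARD('p)) ^ c \<le> (2 / \<delta> ^ 8) ^ (2 * m + 5)"
    using \<open>card U > 0\<close> by simp
  ultimately have bound: "real (c + 1) \<le> 14 * (32 / ln 2)\<^sup>2 * (ln (1 / \<delta>))\<^sup>2"
    using m by (intro log_squared_bound[OF \<delta>0 \<delta>34]) auto

  have l_add: "l j (tr (x + y)) = l j (tr x) + l j (tr y)" if "j < c" for j x y
    using l[OF that trV trV] by (simp only: tr_add)
  have P_add: "P (tr (x + y)) = P (tr x) + P (tr y)" for x y
    using P(1)[OF trV trV] by (simp only: tr_add)
  have "derivs_vanish (Suc 3) g" using g4 by (simp add: eval_nat_numeral)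
  then obtain q where q: "\<forall>j<c. derivs_vanish 3 (q j)"
    "\<And>x. g (P (tr x) + (\<Sum>j<c. scale_fun (l j (tr x)) (e j))) =
        g (P (tr x)) + (\<Sum>j<c. l j (tr x) * q j x)"
    using derivs_vanish_decomposition[of 3 g "\<lambda>x. P (tr x)" c "\<lambda>j x. l j (tr x)" e] P_add l_add by blast
  have g_dec: "g x = (\<Sum>j<c. l j (tr x) * q j x) + g (P (tr x))" for x
    using q(2)[of x] dec[OF trV[of x]] g_tr[of x] by (simp only: add.commute)
  \<comment> \<open>The third derivatives of g composed with P and tr are values of T on U and
    therefore vanish, so the remaining summand is quadratic.\<close>
  have "diff_by y (\<lambda>x. h (P (tr x))) = (\<lambda>x. diff_by (P (tr y)) h (P (tr x)))"
    for y and h :: "(nat \<Rightarrow> 'p mod_ring) \<Rightarrow> 'p mod_ring"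
    by (simp only: diff_by_def P_add)
  then have "derivs_vanish 3 (\<lambda>x. g (P (tr x)))"
    using TU P(2) trV by (simp add: numeral_3_eq_3 third_derivative_eq[OF g4])
  then have "derivs_vanish (Suc 2) (\<lambda>x. g (P (tr x)))" by (simp only: eval_nat_numeral)
  then obtain Q0 where Q0: "Q0 \<in> multipolys n" "fun_degree n (multipoly_eval Q0) \<le> 2"
    "\<And>x. x \<in> carrier_vec n \<Longrightarrow> multipoly_eval Q0 x = g (P (tr (coords n x)))"
    by (rule derivs_vanish_imp_multipoly[where n = n]) blast
  have "\<exists>Q\<in>multipolys n. fun_degree n (multipoly_eval Q) \<le> 2 \<and>
      (\<forall>x\<in>carrier_vec n. multipoly_eval Q x = q j (coords n x))" if "j < c" for j
  proof -
    have "derivs_vanish (Suc 2) (q j)" using q(1) that by (simp only: eval_nat_numeral)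
    then show ?thesis using derivs_vanish_imp_multipoly[where n = n] by metis
  qed
  then obtain Q where Q: "\<And>j. j < c \<Longrightarrow> Q j \<in> multipolys n \<and> fun_degree n (multipoly_eval (Q j)) \<le> 2 \<and>
      (\<forall>x\<in>carrier_vec n. multipoly_eval (Q j) x = q j (coords n x))"
    by metis
  have "\<exists>Q\<in>multipolys n. fun_degree n (multipoly_eval Q) \<le> 1 \<and>
      (\<forall>x\<in>carrier_vec n. multipoly_eval Q x = l j (tr (coords n x)))" if "j < c" for j
  proof -
    have "derivs_vanish (Suc 1) (\<lambda>x. l j (tr x))"
      using derivs_vanish_additive[of "\<lambda>x. l j (tr x)", OF l_add[OF that]] by simp
    then show ?thesis using derivs_vanish_imp_multipoly[where n = n] by metis
  qed
  then obtain L where L: "\<And>j. j < c \<Longrightarrow> L j \<in> multipolys n \<and> fun_degree n (multipoly_eval (L j)) \<le> 1 \<and>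
      (\<forall>x\<in>carrier_vec n. multipoly_eval (L j) x = l j (tr (coords n x)))"
    by metis
  \<comment> \<open>The products are numbered from 0 to c - 1 so far; shifting them by one frees
    index 0 for the summand without linear factor.\<close>
  define Q' where "Q' j = (if j = 0 then Q0 else Q (j - 1))" for j
  have "\<forall>x\<in>carrier_vec n. multipoly_eval f x =
      (\<Sum>j = 1..c. multipoly_eval (L (j - 1)) x * multipoly_eval (Q' j) x) + multipoly_eval (Q' 0) x"
  proof
    fix x :: "'p mod_ring vec" assume x: "x \<in> carrier_vec n"
    have "(\<Sum>j = 1..c. multipoly_eval (L (j - 1)) x * multipoly_eval (Q' j) x) =
        (\<Sum>j<c. l j (tr (coords n x)) * q j (coords n x))"
      using L Q x by (simp add: Q'_def sum.atLeast1_atMost_eq)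
    then show "multipoly_eval f x =
        (\<Sum>j = 1..c. multipoly_eval (L (j - 1)) x * multipoly_eval (Q' j) x) + multipoly_eval (Q' 0) x"
      using g_dec[of "coords n x"] Q0(3)[OF x] g_coords[OF x] by (simp add: Q'_def)
  qed
  moreover have "\<forall>j\<in>{0..c}. Q' j \<in> multipolys n \<and> fun_degree n (multipoly_eval (Q' j)) \<le> 2"
    using Q Q0 by (auto simp: Q'_def)
  moreover have "\<forall>j\<in>{1..c}. L (j - 1) \<in> multipolys n \<and> fun_degree n (multipoly_eval (L (j - 1))) \<le> 1"
    using L by auto
  ultimately show "\<exists>c q l. real (c + 1) \<le> 14 * (32 / ln 2)\<^sup>2 * (ln (1 / \<delta>))\<^sup>2 \<and>
      (\<forall>j\<in>{0..c}. q j \<in> multipolys n \<and> fun_degree n (multipoly_eval (q j)) \<le> 2) \<and>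
      (\<forall>j\<in>{1..c}. l j \<in> multipolys n \<and> fun_degree n (multipoly_eval (l j)) \<le> 1) \<and>
      (\<forall>x\<in>carrier_vec n. multipoly_eval f x =
        (\<Sum>j = 1..c. multipoly_eval (l j) x * multipoly_eval (q j) x) + multipoly_eval (q 0) x)"
    using bound by (intro exI[of _ c] exI[of _ Q'] exI[of _ "\<lambda>j. L (j - 1)"] conjI)
qed

end
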